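(* The min-cost augmentation problem with strict preference lists of length at most 2 can be solved in $O(n_1^2)$ time, where $n_1=|\mathcal{A}|$ is the number of people.
   Context: Popular matchings: a preference instance is a bipartite graph $G=(\mathcal{A}\cup\mathcal{B},E)$ with $\mathcal{A}$ a set of people and $\mathcal{B}$ a set of items; each person ranks the items adjacent to her in order of preference; each item $b$ has a number $\mathsf{copies}(b)$ of copies. A matching $M$ assigns each person at most one acceptable item such that each item $b$ is assigned to at most $\mathsf{copies}(b)$ people (people may be unmatched); $M(a)$ is the item assigned to $a$. A person $a$ prefers $M$ to $M'$ if $a$ is matched in $M$ and unmatched in $M'$, or matched in both and prefers $M(a)$ to $M'(a)$. $M$ is more popular than $M'$ if more people prefer $M$ to $M'$ than prefer $M'$ to $M$; $M$ is popular if no matching is more popular than $M$. Min-cost augmentation problem: the input is a preference instance $G=(\mathcal{A}\cup\mathcal{B},E)$ in which each item is available in one copy, together with a price $\mathsf{cost}(b)\ge 0$ for each $b\in\mathcal{B}$. For any item $b$, extra copies can be added at a price of $\mathsf{cost}(b)$ per copy (with no limit on the number). The task is to choose nonnegative integers $k_b$ (the number of extra copies of $b$) such that the resulting instance (with $\mathsf{copies}(b)=1+k_b$) admits a popular matching, minimizing the total cost $\sum_b k_b\,\mathsf{cost}(b)$. Here "strict preference lists of length at most 2" means every person has no ties and ranks at most 2 items. *)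

theory Defs
  imports Complex_Main "HOL-Library.Landau_Symbols"
begin

section \<open>Popular matchings\<close>

text \<open>A smaller rank is better; equal ranks are ties. Ranks matter only on acceptable items.\<close>

record ('a, 'b) pref_instance =
  people :: "'a set"
  items :: "'b set"
  edges :: "('a \<times> 'b) set"
  rank :: "'a \<Rightarrow> 'b \<Rightarrow> nat"
  copies :: "'b \<Rightarrow> nat"

definition preference_instance :: "('a, 'b) pref_instance \<Rightarrow> bool" where
  "preference_instance G \<longleftrightarrow>
     finite (people G) \<and> finite (items G) \<and> edges G \<subseteq> people G \<times> items G"

definition acceptable :: "('a, 'b) pref_instance \<Rightarrow> 'a \<Rightarrow> 'b set" where
  "acceptable G a = {b. (a, b) \<in> edges G}"

definition matching :: "('a, 'b) pref_instance \<Rightarrow> ('a \<rightharpoonup> 'b) \<Rightarrow> bool" where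
  "matching G M \<longleftrightarrow>
     dom M \<subseteq> people G \<and>
     (\<forall>a b. M a = Some b \<longrightarrow> b \<in> acceptable G a) \<and>
     (\<forall>b\<in>items G. card {a \<in> people G. M a = Some b} \<le> copies G b)"

definition prefers ::
  "('a, 'b) pref_instance \<Rightarrow> 'a \<Rightarrow> ('a \<rightharpoonup> 'b) \<Rightarrow> ('a \<rightharpoonup> 'b) \<Rightarrow> bool" where
  "prefers G a M M' \<longleftrightarrow>
     (case M a of
        None \<Rightarrow> False
      | Some b \<Rightarrow> (case M' a of None \<Rightarrow> True | Some b' \<Rightarrow> rank G a b < rank G a b'))"

definition more_popular ::
  "('a, 'b) pref_instance \<Rightarrow> ('a \<rightharpoonup> 'b) \<Rightarrow> ('a \<rightharpoonup> 'b) \<Rightarrow> bool" where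
  "more_popular G M M' \<longleftrightarrow>
     card {a \<in> people G. prefers G a M M'} > card {a \<in> people G. prefers G a M' M}"

definition popular :: "('a, 'b) pref_instance \<Rightarrow> ('a \<rightharpoonup> 'b) \<Rightarrow> bool" where
  "popular G M \<longleftrightarrow> matching G M \<and> (\<nexists>M'. matching G M' \<and> more_popular G M' M)"

definition admits_popular_matching :: "('a, 'b) pref_instance \<Rightarrow> bool" where
  "admits_popular_matching G \<longleftrightarrow> (\<exists>M. popular G M)"

section \<open>Min-cost augmentation\<close>

definition augment :: "('a, 'b) pref_instance \<Rightarrow> ('b \<Rightarrow> nat) \<Rightarrow> ('a, 'b) pref_instance" where
  "augment G k = G\<lparr>copies := (\<lambda>b. copies G b + k b)\<rparr>"

definition augmentation_cost :: "('a, 'b) pref_instance \<Rightarrow> ('b \<Rightarrow> real) \<Rightarrow> ('b \<Rightarrow> nat) \<Rightarrow> real" where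
  "augmentation_cost G cost k = (\<Sum>b\<in>items G. real (k b) * cost b)"

definition augmentation_input :: "('a, 'b) pref_instance \<Rightarrow> ('b \<Rightarrow> real) \<Rightarrow> bool" where
  "augmentation_input G cost \<longleftrightarrow>
     preference_instance G \<and> (\<forall>b\<in>items G. copies G b = 1) \<and> (\<forall>b\<in>items G. cost b \<ge> 0)"

definition min_cost_augmentation ::
  "('a, 'b) pref_instance \<Rightarrow> ('b \<Rightarrow> real) \<Rightarrow> ('b \<Rightarrow> nat) \<Rightarrow> bool" where
  "min_cost_augmentation G cost k \<longleftrightarrow>
     admits_popular_matching (augment G k) \<and>
     (\<forall>k'. admits_popular_matching (augment G k') \<longrightarrow>
        augmentation_cost G cost k \<le> augmentation_cost G cost k')"

definition strict_prefs :: "('a, 'b) pref_instance \<Rightarrow> bool" where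
  "strict_prefs G \<longleftrightarrow> (\<forall>a\<in>people G. inj_on (rank G a) (acceptable G a))"

definition lists_length_le :: "nat \<Rightarrow> ('a, 'b) pref_instance \<Rightarrow> bool" where
  "lists_length_le d G \<longleftrightarrow> (\<forall>a\<in>people G. card (acceptable G a) \<le> d)"

text \<open>The acceptable items of a person, best first; meaningful under strict preferences.\<close>

definition pref_list :: "('a, 'b) pref_instance \<Rightarrow> 'a \<Rightarrow> 'b list" where
  "pref_list G a =
     map (inv_into (acceptable G a) (rank G a)) (sorted_list_of_set (rank G a ` acceptable G a))"

section \<open>A random access machine\<close>

text \<open>
  Running time is measured in a structured RAM: a program works on finitely many named
  zero-initialised arrays, indexed by natural numbers, with indirect addressing. Entries are
  natural numbers or reals. Every elementary operation (reading or writing a cell, addition,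
  truncated or real subtraction, comparison, branching) takes one time step. There is no
  multiplication, and reals cannot be converted to natural numbers: prices can only
  be copied, added, subtracted and compared.
\<close>

record state =
  nmem :: "string \<Rightarrow> nat \<Rightarrow> nat"
  rmem :: "string \<Rightarrow> nat \<Rightarrow> real"

datatype nexp = Num nat | NCell string nexp | NAdd nexp nexp | NSub nexp nexp

datatype rexp = RCell string nexp | RAdd rexp rexp | RSub rexp rexp

datatype bexp = NLess nexp nexp | RLess rexp rexp | Neg bexp | Conj bexp bexp

datatype com =
    Skip
  | NWrite string nexp nexp
  | RWrite string nexp rexp
  | Seq com com
  | Cond bexp com com
  | While bexp com

primrec nval :: "nexp \<Rightarrow> state \<Rightarrow> nat" where
  "nval (Num n) s = n"
| "nval (NCell x e) s = nmem s x (nval e s)"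
| "nval (NAdd e e') s = nval e s + nval e' s"
| "nval (NSub e e') s = nval e s - nval e' s"

primrec rval :: "rexp \<Rightarrow> state \<Rightarrow> real" where
  "rval (RCell x e) s = rmem s x (nval e s)"
| "rval (RAdd e e') s = rval e s + rval e' s"
| "rval (RSub e e') s = rval e s - rval e' s"

primrec bval :: "bexp \<Rightarrow> state \<Rightarrow> bool" where
  "bval (NLess e e') s \<longleftrightarrow> nval e s < nval e' s"
| "bval (RLess e e') s \<longleftrightarrow> rval e s < rval e' s"
| "bval (Neg b) s \<longleftrightarrow> \<not> bval b s"
| "bval (Conj b b') s \<longleftrightarrow> bval b s \<and> bval b' s"

primrec ntime :: "nexp \<Rightarrow> nat" where
  "ntime (Num n) = 1"
| "ntime (NCell x e) = 1 + ntime e"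
| "ntime (NAdd e e') = 1 + ntime e + ntime e'"
| "ntime (NSub e e') = 1 + ntime e + ntime e'"

primrec rtime :: "rexp \<Rightarrow> nat" where
  "rtime (RCell x e) = 1 + ntime e"
| "rtime (RAdd e e') = 1 + rtime e + rtime e'"
| "rtime (RSub e e') = 1 + rtime e + rtime e'"

primrec btime :: "bexp \<Rightarrow> nat" where
  "btime (NLess e e') = 1 + ntime e + ntime e'"
| "btime (RLess e e') = 1 + rtime e + rtime e'"
| "btime (Neg b) = 1 + btime b"
| "btime (Conj b b') = 1 + btime b + btime b'"

definition nwrite :: "string \<Rightarrow> nat \<Rightarrow> nat \<Rightarrow> state \<Rightarrow> state" where
  "nwrite x i v s = s\<lparr>nmem := (nmem s)(x := (nmem s x)(i := v))\<rparr>"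

definition rwrite :: "string \<Rightarrow> nat \<Rightarrow> real \<Rightarrow> state \<Rightarrow> state" where
  "rwrite x i v s = s\<lparr>rmem := (rmem s)(x := (rmem s x)(i := v))\<rparr>"

text \<open>\<open>exec c s t s'\<close>: started in \<open>s\<close>, the program \<open>c\<close> halts in \<open>s'\<close> after \<open>t\<close> steps.\<close>

inductive exec :: "com \<Rightarrow> state \<Rightarrow> nat \<Rightarrow> state \<Rightarrow> bool" where
  Skip: "exec Skip s 1 s"
| NWrite: "exec (NWrite x i e) s (1 + ntime i + ntime e) (nwrite x (nval i s) (nval e s) s)"
| RWrite: "exec (RWrite x i e) s (1 + ntime i + rtime e) (rwrite x (nval i s) (rval e s) s)"
| Seq: "exec c s t s' \<Longrightarrow> exec c' s' t' s'' \<Longrightarrow> exec (Seq c c') s (t + t') s''"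
| CondTrue: "bval b s \<Longrightarrow> exec c s t s' \<Longrightarrow> exec (Cond b c c') s (1 + btime b + t) s'"
| CondFalse: "\<not> bval b s \<Longrightarrow> exec c' s t s' \<Longrightarrow> exec (Cond b c c') s (1 + btime b + t) s'"
| WhileFalse: "\<not> bval b s \<Longrightarrow> exec (While b c) s (1 + btime b) s"
| WhileTrue: "bval b s \<Longrightarrow> exec c s t s' \<Longrightarrow> exec (While b c) s' t' s'' \<Longrightarrow>
    exec (While b c) s (1 + btime b + t + t') s''"

inductive_cases SkipE: "exec Skip s t s'"
inductive_cases NWriteE: "exec (NWrite x i e) s t s'"
inductive_cases RWriteE: "exec (RWrite x i e) s t s'"
inductive_cases SeqE: "exec (Seq c c') s t s'"
inductive_cases CondE: "exec (Cond b c c') s t s'"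
inductive_cases WhileE: "exec (While b c) s t s'"

lemma exec_deterministic: "exec c s t s' \<Longrightarrow> exec c s u v \<Longrightarrow> u = t \<and> v = s'"
proof (induction arbitrary: u v rule: exec.induct)
  case Skip
  then show ?case by (auto elim: SkipE)
next
  case NWrite
  then show ?case by (auto elim: NWriteE)
next
  case RWrite
  then show ?case by (auto elim: RWriteE)
next
  case (Seq c s t s' c' t' s'')
  from Seq.prems obtain t1 s1 t2 where
    "exec c s t1 s1" "exec c' s1 t2 v" "u = t1 + t2"
    by (rule SeqE)
  with Seq.IH show ?case by blast
next
  case (CondTrue b s c t s' c')
  from CondTrue.prems CondTrue.hyps(1) obtain t1 where "exec c s t1 v" "u = 1 + btime b + t1"
    by (auto elim: CondE)
  with CondTrue.IH show ?case by blast
next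
  case (CondFalse b s c' t s' c)
  from CondFalse.prems CondFalse.hyps(1) obtain t1 where "exec c' s t1 v" "u = 1 + btime b + t1"
    by (auto elim: CondE)
  with CondFalse.IH show ?case by blast
next
  case WhileFalse
  then show ?case by (auto elim: WhileE)
next
  case (WhileTrue b s c t s' t' s'')
  from WhileTrue.prems WhileTrue.hyps(1) obtain t1 s1 t2 where
    "exec c s t1 s1" "exec (While b c) s1 t2 v" "u = 1 + btime b + t1 + t2"
    by (auto elim: WhileE)
  with WhileTrue.IH show ?case by blast
qed

section \<open>Input and output\<close>

text \<open>
  People and items are numbered \<open>0, 1, \<dots>\<close>. The input consists of the two sizes (in cell 0 of
  an array each), for each person the length of the preference list and its first and second
  entry where present, and the price of each item.
\<close>

definition encode :: "(nat, nat) pref_instance \<Rightarrow> (nat \<Rightarrow> real) \<Rightarrow> state" where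
  "encode G cost =
     \<lparr>nmem = (\<lambda>_ _. 0)
        (''n1'' := (\<lambda>_. 0)(0 := card (people G)),
         ''n2'' := (\<lambda>_. 0)(0 := card (items G)),
         ''len'' := (\<lambda>a. if a \<in> people G then length (pref_list G a) else 0),
         ''first'' := (\<lambda>a. if a \<in> people G \<and> 0 < length (pref_list G a)
                          then pref_list G a ! 0 else 0),
         ''second'' := (\<lambda>a. if a \<in> people G \<and> 1 < length (pref_list G a)
                           then pref_list G a ! 1 else 0)),
      rmem = (\<lambda>_ _. 0)(''cost'' := (\<lambda>b. if b \<in> items G then cost b else 0))\<rparr>"

definition extra_copies :: "state \<Rightarrow> nat \<Rightarrow> nat" where
  "extra_copies s = nmem s ''extra''"

end

theory Submission
  imports Defs
begin

text \<open>
  Call a person contested if she has a second choice and it is nobody's first choice. If a popular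
  matching exists, all contested persons are matched in it. Conversely, an assignment of the contested
  persons to items on their lists extends to a popular matching if no first choice has more copies
  than people ranking it first. So contested persons are edges of a multigraph on the items that
  have to be oriented towards an endpoint, where every item receives one edge for free and pays its
  price for each further one. The edges received for free form a pseudoforest (at most one cycle per component)
  and each remaining edge pays for its cheaper endpoint; hence one wants a pseudoforest of
  maximum weight, an edge being weighted by the price of its cheaper endpoint. Pseudoforests are the independent
  sets of a matroid, so a Kruskal-like greedy algorithm finds one. With component labels that are updated naively
  and a linear search for the heaviest remaining edge, each of the \<open>n\<^sub>1\<close> rounds takes linear time.
\<close>

section \<open>Greedy pseudoforests\<close>

text \<open>Optimality is certified by duality rather than by exchanging edges: each rejection
  leaves behind a set of expensive items that spans too many edges to be served without buying
  copies, and comparing these counts at every price level bounds the cost from below. The upper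
  bound has an obstacle of its own: an orientation is known to yield a popular matching only if no
  first choice has more copies than people ranking it first, so the copies bought must all be put to
  use. The greedy result achieves this by itself: an item with extra copies lies in a component that
  has as many accepted edges as items, so its free copy is used too, and a contested person who is
  assigned a first choice ranks it first. A time bound in \<open>n1\<close> alone forbids any loop
  over the items, of which there may be far more than people; their cells are reached only through
  list entries. Absent entries read as 0, so 0 may become a vertex without being on any list, or
  even being an item; it is then isolated and does no harm.\<close>

locale edge_greedy =
  fixes f g :: "nat \<Rightarrow> nat" and E V :: "nat set" and w :: "nat \<Rightarrow> real"
  assumes finite_E: "finite E" and finite_V: "finite V"
    and f_V: "a \<in> E \<Longrightarrow> f a \<in> V" and g_V: "a \<in> E \<Longrightarrow> g a \<in> V"
begin

definition cheaper :: "nat \<Rightarrow> nat" where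
  "cheaper a = (if w (f a) < w (g a) then f a else g a)"

definition weight :: "nat \<Rightarrow> real" where
  "weight a = w (cheaper a)"

lemma weight_le: "weight a \<le> w (f a)" "weight a \<le> w (g a)"
  by (auto simp: weight_def cheaper_def)

definition spanned :: "nat set \<Rightarrow> nat set" where
  "spanned S = {a \<in> E. f a \<in> S \<and> g a \<in> S}"

text \<open>\<open>A\<close> and \<open>R\<close> are the accepted and the rejected edges, \<open>lab\<close> labels the components of \<open>A\<close>, and
  \<open>cyc\<close> marks those that contain a cycle. Two clauses carry the argument: an orientation of \<open>A\<close> can
  keep one prescribed vertex of each tree component free, so a further edge can be oriented to it; and every rejected
  edge comes with a set \<open>S\<close> of expensive items that spans too many edges, a lower bound for any solution.\<close>

definition greedy_inv ::
  "(nat \<Rightarrow> nat) \<Rightarrow> (nat \<Rightarrow> bool) \<Rightarrow> (nat \<Rightarrow> nat) \<Rightarrow> nat set \<Rightarrow> nat set \<Rightarrow> bool" where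
  "greedy_inv lab cyc ext A R \<longleftrightarrow>
     A \<subseteq> E \<and> R \<subseteq> E \<and> A \<inter> R = {} \<and>
     (\<forall>d\<in>A \<union> R. \<forall>e\<in>E - (A \<union> R). weight e \<le> weight d) \<and>
     (\<forall>a\<in>A. lab (f a) = lab (g a)) \<and>
     (\<forall>c\<in>lab ` V. card {a \<in> A. lab (f a) = c} + (if cyc c then 0 else 1) = card {b \<in> V. lab b = c}) \<and>
     (\<forall>a\<in>R. cyc (lab (f a)) \<and> cyc (lab (g a))) \<and>
     (\<forall>U\<subseteq>V. inj_on lab U \<longrightarrow> (\<forall>u\<in>U. \<not> cyc (lab u)) \<longrightarrow>
        (\<exists>h. inj_on h A \<and> (\<forall>a\<in>A. h a = f a \<or> h a = g a) \<and> h ` A \<inter> U = {})) \<and>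
     (\<forall>b. ext b = card {a \<in> R. cheaper a = b}) \<and>
     (\<forall>e\<in>R. \<exists>S\<subseteq>f ` E \<union> g ` E. (\<forall>b\<in>S. weight e \<le> w b) \<and>
        card S + card {d \<in> R. weight e \<le> weight d} \<le> card (spanned S))"

section \<open>Preservation of the greedy invariant\<close>

lemma greedy_inv_orient_avoiding:
  assumes "greedy_inv lab cyc ext A R" and "U \<subseteq> V" and "inj_on lab U" and "\<And>u. u \<in> U \<Longrightarrow> \<not> cyc (lab u)"
  shows "\<exists>h. inj_on h A \<and> (\<forall>a\<in>A. h a = f a \<or> h a = g a) \<and> h ` A \<inter> U = {}"
proof -
  have "\<forall>U\<subseteq>V. inj_on lab U \<longrightarrow> (\<forall>u\<in>U. \<not> cyc (lab u)) \<longrightarrow>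
        (\<exists>h. inj_on h A \<and> (\<forall>a\<in>A. h a = f a \<or> h a = g a) \<and> h ` A \<inter> U = {})"
    using assms(1) unfolding greedy_inv_def by (elim conjE)
  then show ?thesis using assms(2-4) by simp
qed

lemma greedy_inv_dense_set:
  assumes "greedy_inv lab cyc ext A R" and "e \<in> R"
  obtains S where "S \<subseteq> f ` E \<union> g ` E" and "\<And>b. b \<in> S \<Longrightarrow> weight e \<le> w b"
    and "card S + card {d \<in> R. weight e \<le> weight d} \<le> card (spanned S)"
proof -
  have "\<forall>e\<in>R. \<exists>S\<subseteq>f ` E \<union> g ` E. (\<forall>b\<in>S. weight e \<le> w b) \<and>
        card S + card {d \<in> R. weight e \<le> weight d} \<le> card (spanned S)"
    using assms(1) unfolding greedy_inv_def by (elim conjE)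
  then show thesis using assms(2) that by blast
qed

lemma greedy_inv_init: "greedy_inv id (\<lambda>_. False) (\<lambda>_. 0) {} {}"
proof -
  have "{b \<in> V. b = c} = {c}" if "c \<in> V" for c using that by auto
  then show ?thesis by (auto simp: greedy_inv_def)
qed

text \<open>Needed because the arrays of the program hold the intended labels only at cells in
  \<open>V\<close>: neither the initialisation nor a merge touches any other cell.\<close>

lemma greedy_inv_cong:
  assumes "greedy_inv lab cyc ext A R" and "\<And>b. b \<in> V \<Longrightarrow> lab' b = lab b"
  shows "greedy_inv lab' cyc ext A R"
proof -
  have fg: "lab' (f a) = lab (f a)" "lab' (g a) = lab (g a)" if "a \<in> E" for a
    using that assms(2) f_V g_V by auto
  have sub: "A \<subseteq> E" "R \<subseteq> E" using assms(1) by (auto simp: greedy_inv_def)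
  have img: "lab' ` V = lab ` V" using assms(2) by (intro image_cong) auto
  have c1: "{a \<in> A. lab' (f a) = c} = {a \<in> A. lab (f a) = c}" for c using fg sub by auto
  have c2: "{b \<in> V. lab' b = c} = {b \<in> V. lab b = c}" for c using assms(2) by auto
  have u1: "inj_on lab' U = inj_on lab U" if "U \<subseteq> V" for U
    using that assms(2) by (intro inj_on_cong) auto
  have u2: "(\<forall>u\<in>U. \<not> cyc (lab' u)) = (\<forall>u\<in>U. \<not> cyc (lab u))" if "U \<subseteq> V" for U
    using that assms(2) by (metis subsetD)
  have c3: "(\<forall>a\<in>A. lab' (f a) = lab' (g a)) = (\<forall>a\<in>A. lab (f a) = lab (g a))"
    "(\<forall>a\<in>R. cyc (lab' (f a)) \<and> cyc (lab' (g a))) = (\<forall>a\<in>R. cyc (lab (f a)) \<and> cyc (lab (g a)))"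
    using fg sub by (metis subsetD)+
  show ?thesis
    using assms(1) u1 u2 unfolding greedy_inv_def img c1 c2 c3 by simp
qed

text \<open>A component marked cyclic has as many accepted edges as vertices, and all rejected
  edges, including \<open>e\<close>, have both endpoints in such components. So the vertices of
  these components span at least that many edges plus all rejected ones, which makes them a
  certificate for \<open>e\<close>.\<close>

lemma greedy_inv_reject:
  assumes inv: "greedy_inv lab cyc ext A R"
    and e: "e \<in> E - (A \<union> R)" and max: "\<And>d. d \<in> E - (A \<union> R) \<Longrightarrow> weight d \<le> weight e"
    and cyc: "cyc (lab (f e))" "cyc (lab (g e))"
  shows "greedy_inv lab cyc (ext(cheaper e := Suc (ext (cheaper e)))) A (insert e R)"
proof -
  have sub: "A \<subseteq> E" "R \<subseteq> E" "A \<inter> R = {}" using inv by (auto simp: greedy_inv_def)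
  have fin: "finite A" "finite R" using sub finite_E by (auto intro: finite_subset)
  have ext: "ext b = card {a \<in> R. cheaper a = b}" for b using inv by (auto simp: greedy_inv_def)
  have ord: "weight e \<le> weight d" if "d \<in> A \<union> R" for d
    using inv e that by (auto simp: greedy_inv_def)
  have Rcyc: "cyc (lab (f a)) \<and> cyc (lab (g a))" if "a \<in> R" for a
    using inv that by (auto simp: greedy_inv_def)
  have Alab: "lab (f a) = lab (g a)" if "a \<in> A" for a
    using inv that by (auto simp: greedy_inv_def)
  have cnt: "card {a \<in> A. lab (f a) = c} + (if cyc c then 0 else 1) = card {b \<in> V. lab b = c}"
    if "c \<in> lab ` V" for c
    using inv that by (auto simp: greedy_inv_def)
  have ext': "(ext(cheaper e := Suc (ext (cheaper e)))) b = card {a \<in> insert e R. cheaper a = b}" for b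
  proof (cases "b = cheaper e")
    case True
    have "{a \<in> insert e R. cheaper a = b} = insert e {a \<in> R. cheaper a = b}" using True by auto
    then show ?thesis using True e fin by (simp add: ext)
  next
    case False
    then have "{a \<in> insert e R. cheaper a = b} = {a \<in> R. cheaper a = b}" by auto
    then show ?thesis using False by (simp add: ext)
  qed
  define D where "D = A \<union> insert e R"
  \<comment> \<open>Restricting to endpoints of processed edges makes every member of
    \<open>S\<close> cost at least \<open>weight e\<close>, since edges are processed by
    non-increasing weight. The processed edges inside cyclic components are still spanned, and only
    an upper bound on \<open>card S\<close> is used.\<close>
  define S where "S = {b \<in> V. cyc (lab b)} \<inter> (f ` D \<union> g ` D)"
  have S_le: "card S \<le> card {a \<in> A. cyc (lab (f a))}"
  proof -
    have "card S \<le> card {b \<in> V. cyc (lab b)}"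
      unfolding S_def using finite_V by (intro card_mono) auto
    also have "{b \<in> V. cyc (lab b)} = (\<Union>c\<in>{c \<in> lab ` V. cyc c}. {b \<in> V. lab b = c})" by auto
    also have "card \<dots> = (\<Sum>c\<in>{c \<in> lab ` V. cyc c}. card {b \<in> V. lab b = c})"
      using finite_V by (intro card_UN_disjoint) auto
    also have "\<dots> = (\<Sum>c\<in>{c \<in> lab ` V. cyc c}. card {a \<in> A. lab (f a) = c})"
      using cnt by (intro sum.cong) (simp_all, force)
    also have "\<dots> = card (\<Union>c\<in>{c \<in> lab ` V. cyc c}. {a \<in> A. lab (f a) = c})"
      using finite_V fin by (intro card_UN_disjoint[symmetric]) auto
    also have "\<dots> \<le> card {a \<in> A. cyc (lab (f a))}"
      using fin by (intro card_mono) auto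
    finally show ?thesis .
  qed
  have "card S + card (insert e R) \<le> card {a \<in> A. cyc (lab (f a))} + card (insert e R)"
    using S_le by simp
  also have "\<dots> = card ({a \<in> A. cyc (lab (f a))} \<union> insert e R)"
    using fin sub e by (intro card_Un_disjoint[symmetric]) auto
  also have "\<dots> \<le> card (spanned S)"
    using e sub f_V g_V Alab Rcyc cyc finite_E
    by (intro card_mono) (auto simp: spanned_def S_def D_def)
  finally have S: "card S + card (insert e R) \<le> card (spanned S)" .
  have Sw: "weight e \<le> w b" if b: "b \<in> S" for b
  proof -
    obtain d where d: "d \<in> D" "b = f d \<or> b = g d" using b unfolding S_def by blast
    then have "weight e \<le> weight d" using ord by (auto simp: D_def)
    with d weight_le[of d] show ?thesis by auto
  qed
  have S': "card S + card {d \<in> insert e R. weight e \<le> weight d} \<le> card (spanned S)"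
    by (rule order_trans[OF add_left_mono[OF card_mono] S]) (use fin in auto)
  have Ssub: "S \<subseteq> f ` E \<union> g ` E" using e sub by (auto simp: S_def D_def)
  have cert: "\<exists>S\<subseteq>f ` E \<union> g ` E. (\<forall>b\<in>S. weight r \<le> w b) \<and>
      card S + card {d \<in> insert e R. weight r \<le> weight d} \<le> card (spanned S)"
    if r: "r \<in> insert e R" for r
  \<comment> \<open>An edge \<open>r\<close> no heavier than \<open>e\<close> has the same weight,
    so the new \<open>S\<close> serves it too; for a heavier one \<open>e\<close> lies below the
    threshold, and the old certificate persists.\<close>
  proof (cases "weight r \<le> weight e")
    case True
    then have "weight r = weight e" using r ord[of r] by auto
    then show ?thesis using S' Sw Ssub by (intro exI[of _ S]) auto
  next
    case False
    then have "{d \<in> insert e R. weight r \<le> weight d} = {d \<in> R. weight r \<le> weight d}" "r \<in> R"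
      using r by auto
    with inv show ?thesis by (simp add: greedy_inv_def)
  qed
  have P1: "A \<subseteq> E" "insert e R \<subseteq> E" "A \<inter> insert e R = {}" using sub e by auto
  have P2: "\<forall>d\<in>A \<union> insert e R. \<forall>x\<in>E - (A \<union> insert e R). weight x \<le> weight d"
    using inv max by (auto simp: greedy_inv_def)
  have P3: "\<forall>a\<in>insert e R. cyc (lab (f a)) \<and> cyc (lab (g a))" using Rcyc cyc by auto
  have P4: "\<forall>a\<in>A. lab (f a) = lab (g a)" using Alab by blast
  have P5: "\<forall>c\<in>lab ` V. card {a \<in> A. lab (f a) = c} + (if cyc c then 0 else 1) = card {b \<in> V. lab b = c}"
    using cnt by blast
  have P6: "\<forall>U\<subseteq>V. inj_on lab U \<longrightarrow> (\<forall>u\<in>U. \<not> cyc (lab u)) \<longrightarrow>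
        (\<exists>h. inj_on h A \<and> (\<forall>a\<in>A. h a = f a \<or> h a = g a) \<and> h ` A \<inter> U = {})"
    by (intro allI impI greedy_inv_orient_avoiding[OF inv]) auto
  show ?thesis
    unfolding greedy_inv_def
    by (intro conjI P1 P2 P3 P4 P5 P6 ballI[OF cert] allI[OF ext'])
qed

text \<open>Some endpoint lies in a tree component, and the old orientation can be made to leave
  precisely that endpoint free; the edge is then oriented to it. Merging two trees gives a tree,
  while an edge inside a tree or between a tree and a cyclic component leaves a cyclic one.\<close>

lemma greedy_inv_accept:
  assumes inv: "greedy_inv lab cyc ext A R"
    and e: "e \<in> E - (A \<union> R)" and max: "\<And>d. d \<in> E - (A \<union> R) \<Longrightarrow> weight d \<le> weight e"
    and ncyc: "\<not> (cyc (lab (f e)) \<and> cyc (lab (g e)))"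
    and p: "p = lab (f e)" and q: "q = lab (g e)"
    and lab': "lab' = (\<lambda>b. if lab b = p then q else lab b)"
    and cyc': "cyc' = (\<lambda>c. cyc c \<or> c = q \<and> (p = q \<or> cyc p))"
  shows "greedy_inv lab' cyc' ext (insert e A) R"
proof -
  have sub: "A \<subseteq> E" "R \<subseteq> E" "A \<inter> R = {}" using inv by (auto simp: greedy_inv_def)
  have fin: "finite A" "finite R" using sub finite_E by (auto intro: finite_subset)
  have ord: "weight e \<le> weight d" if "d \<in> A \<union> R" for d
    using inv e that by (auto simp: greedy_inv_def)
  have Rcyc: "cyc (lab (f a)) \<and> cyc (lab (g a))" if "a \<in> R" for a
    using inv that by (auto simp: greedy_inv_def)
  have Alab: "lab (f a) = lab (g a)" if "a \<in> A" for a
    using inv that by (auto simp: greedy_inv_def)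
  have cnt: "card {a \<in> A. lab (f a) = c} + (if cyc c then 0 else 1) = card {b \<in> V. lab b = c}"
    if "c \<in> lab ` V" for c
    using inv that by (auto simp: greedy_inv_def)
  have ori: "\<exists>h. inj_on h A \<and> (\<forall>a\<in>A. h a = f a \<or> h a = g a) \<and> h ` A \<inter> U = {}"
    if "U \<subseteq> V" "inj_on lab U" "\<And>u. u \<in> U \<Longrightarrow> \<not> cyc (lab u)" for U
    using greedy_inv_orient_avoiding[OF inv] that by blast
  have pV: "p \<in> lab ` V" "q \<in> lab ` V" using p q e f_V g_V by auto
  have P1: "insert e A \<subseteq> E" "R \<subseteq> E" "insert e A \<inter> R = {}" using sub e by auto
  have P2: "\<forall>d\<in>insert e A \<union> R. \<forall>x\<in>E - (insert e A \<union> R). weight x \<le> weight d"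
    using inv max by (auto simp: greedy_inv_def)
  have P3: "\<forall>a\<in>insert e A. lab' (f a) = lab' (g a)"
    using Alab p q by (auto simp: lab')
  have P4: "\<forall>a\<in>R. cyc' (lab' (f a)) \<and> cyc' (lab' (g a))"
    using Rcyc by (auto simp: lab' cyc')
  have P5: "card {a \<in> insert e A. lab' (f a) = c} + (if cyc' c then 0 else 1) = card {b \<in> V. lab' b = c}"
    if c: "c \<in> lab' ` V" for c
  proof (cases "c = q")
    case True
    have eA: "card {a \<in> insert e A. lab' (f a) = q} = Suc (card {a \<in> A. lab' (f a) = q})"
    proof -
      have "{a \<in> insert e A. lab' (f a) = q} = insert e {a \<in> A. lab' (f a) = q}"
        using p by (auto simp: lab')
      then show ?thesis using e fin by simp
    qed
    show ?thesis
    proof (cases "p = q")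
      case same: True
      then have "lab' = lab" by (auto simp: lab')
      moreover have "\<not> cyc q" using ncyc same p q by auto
      ultimately show ?thesis using cnt[OF pV(2)] eA True same by (auto simp: cyc')
    next
      case False
      have "{a \<in> A. lab' (f a) = q} = {a \<in> A. lab (f a) = p} \<union> {a \<in> A. lab (f a) = q}"
        by (auto simp: lab')
      then have a: "card {a \<in> A. lab' (f a) = q} = card {a \<in> A. lab (f a) = p} + card {a \<in> A. lab (f a) = q}"
        using fin False by (simp add: card_Un_disjoint disjoint_iff)
      have "{b \<in> V. lab' b = q} = {b \<in> V. lab b = p} \<union> {b \<in> V. lab b = q}"
        by (auto simp: lab')
      then have b: "card {b \<in> V. lab' b = q} = card {b \<in> V. lab b = p} + card {b \<in> V. lab b = q}"
        using finite_V False by (simp add: card_Un_disjoint disjoint_iff)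
      \<comment> \<open>Each tree has one vertex more than edges. The new edge absorbs one such
        surplus: two trees keep one, a tree and a cyclic component keep none.\<close>
      show ?thesis
        using a b eA True False ncyc cnt[OF pV(1)] cnt[OF pV(2)] p q
        by (auto simp: cyc' split: if_splits)
    qed
  next
    case False
    have cp: "c \<noteq> p" using c False by (auto simp: lab' split: if_splits)
    have "{a \<in> insert e A. lab' (f a) = c} = {a \<in> A. lab (f a) = c}"
      using False cp p by (auto simp: lab')
    moreover have "{b \<in> V. lab' b = c} = {b \<in> V. lab b = c}" "c \<in> lab ` V"
      using False cp c by (auto simp: lab' split: if_splits)
    ultimately show ?thesis using cnt[of c] False by (simp add: cyc')
  qed
  have P6: "\<exists>h. inj_on h (insert e A) \<and> (\<forall>a\<in>insert e A. h a = f a \<or> h a = g a) \<and> h ` insert e A \<inter> U = {}"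
    if U: "U \<subseteq> V" "inj_on lab' U" "\<forall>u\<in>U. \<not> cyc' (lab' u)" for U
  proof -
    have "inj_on lab U" using U(2) by (auto simp: inj_on_def lab')
    have Uc: "\<not> cyc (lab u)" if "u \<in> U" for u using U(3) that by (auto simp: lab' cyc' split: if_splits)
    \<comment> \<open>The endpoint \<open>z\<close> is to receive \<open>e\<close>, so it must be
      free of \<open>A\<close> and outside \<open>U\<close>. If the merged component is cyclic,
      \<open>U\<close> avoids it altogether and any endpoint in a tree will do; if two trees become
      one, \<open>U\<close> meets at most one of them, having at most one vertex per merged
      component.\<close>
    have "\<exists>z. (z = f e \<or> z = g e) \<and> \<not> cyc (lab z) \<and> (\<forall>u\<in>U. lab u \<noteq> lab z)"
    proof (cases "cyc p \<or> cyc q \<or> p = q")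
      case True
      then have "cyc' q" by (auto simp: cyc')
      then have "lab u \<noteq> p" "lab u \<noteq> q" if "u \<in> U" for u using that U(3) by (auto simp: lab')
      then show ?thesis using ncyc p q by metis
    next
      case False
      have "(\<forall>u\<in>U. lab u \<noteq> p) \<or> (\<forall>u\<in>U. lab u \<noteq> q)"
      proof (rule ccontr)
        assume "\<not> ?thesis"
        then obtain u u' where "u \<in> U" "lab u = p" "u' \<in> U" "lab u' = q" by auto
        then have "u = u'" using U(2) by (auto simp: inj_on_def lab')
        then show False using \<open>lab u = p\<close> \<open>lab u' = q\<close> False by auto
      qed
      then show ?thesis using False p q by auto
    qed
    then obtain z where z: "z = f e \<or> z = g e" "\<not> cyc (lab z)" "\<forall>u\<in>U. lab u \<noteq> lab z" by blast
    \<comment> \<open>Adding \<open>z\<close> to the vertices kept free is the reason why the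
      invariant quantifies over all partial transversals \<open>U\<close> of the tree
      components.\<close>
    have "inj_on lab (insert z U)" using \<open>inj_on lab U\<close> z(3) by (auto simp: inj_on_def)
    moreover have "insert z U \<subseteq> V" using z U e f_V g_V by auto
    moreover have "\<not> cyc (lab u)" if "u \<in> insert z U" for u using that z(2) Uc by auto
    ultimately obtain h where h: "inj_on h A" "\<forall>a\<in>A. h a = f a \<or> h a = g a" "h ` A \<inter> insert z U = {}"
      using ori[of "insert z U"] by auto
    have zU: "z \<notin> U" using z(3) by auto
    have im: "(h(e := z)) ` A = h ` A" using e by (intro image_cong) auto
    have "inj_on (h(e := z)) A" using h(1) e by (auto simp: inj_on_def)
    then have "inj_on (h(e := z)) (insert e A)"
      using im h(3) e by (simp add: inj_on_insert)
    then show ?thesis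
      using h im zU z(1) e by (intro exI[of _ "h(e := z)"]) auto
  qed
  have P7: "\<forall>b. ext b = card {a \<in> R. cheaper a = b}" using inv by (simp add: greedy_inv_def)
  have P8: "\<forall>r\<in>R. \<exists>S\<subseteq>f ` E \<union> g ` E. (\<forall>b\<in>S. weight r \<le> w b) \<and>
        card S + card {d \<in> R. weight r \<le> weight d} \<le> card (spanned S)"
    using inv unfolding greedy_inv_def by (elim conjE)
  have P6': "\<forall>U\<subseteq>V. inj_on lab' U \<longrightarrow> (\<forall>u\<in>U. \<not> cyc' (lab' u)) \<longrightarrow>
     (\<exists>h. inj_on h (insert e A) \<and> (\<forall>a\<in>insert e A. h a = f a \<or> h a = g a) \<and> h ` insert e A \<inter> U = {})"
    by (intro allI impI P6)
  show ?thesis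
    unfolding greedy_inv_def
    by (intro conjI P1 P2 P3 P4 P6' P7 P8 ballI[OF P5])
qed

end

text \<open>The premise is Hall's condition for a nested family: units priced at least
  \<open>v e\<close> are no fewer than the elements of \<open>R\<close> weighing at least that much.
  So the heaviest element may be paired with any unit costing at least as much, and induction does
  the rest. Nonnegative prices take care of the units left over.\<close>

lemma sum_threshold_le:
  fixes x :: "'b \<Rightarrow> nat" and w :: "'b \<Rightarrow> real" and v :: "'e \<Rightarrow> real"
  assumes "finite R" and "finite B" and "\<And>b. b \<in> B \<Longrightarrow> 0 \<le> w b"
    and "\<And>e. e \<in> R \<Longrightarrow> card {d \<in> R. v e \<le> v d} \<le> (\<Sum>b | b \<in> B \<and> v e \<le> w b. x b)"
  shows "(\<Sum>e\<in>R. v e) \<le> (\<Sum>b\<in>B. real (x b) * w b)"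
  using assms(1,4)
proof (induction "card R" arbitrary: R x)
  case 0
  then show ?case using assms(3) by (auto intro!: sum_nonneg)
next
  case (Suc n)
  define m where "m = Max (v ` R)"
  have ne: "v ` R \<noteq> {}" using Suc by auto
  then have "m \<in> v ` R" unfolding m_def using Suc.prems by (intro Max_in) auto
  then obtain e where e: "e \<in> R" "v e = m" by auto
  have emax: "v d \<le> v e" if "d \<in> R" for d using that Suc.prems e by (auto simp: m_def)
  have "1 \<le> card {d \<in> R. v e \<le> v d}"
    using e Suc.prems(1) by (metis (mono_tags, lifting) One_nat_def Suc_leI card_gt_0_iff empty_iff finite_subset mem_Collect_eq order_refl subsetI)
  also have "\<dots> \<le> (\<Sum>b | b \<in> B \<and> v e \<le> w b. x b)" using Suc.prems e by blast
  finally obtain b where b: "b \<in> B" "v e \<le> w b" "x b > 0"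
    by (metis (mono_tags, lifting) mem_Collect_eq neq0_conv not_one_le_zero sum.neutral)
  define y where "y = x(b := x b - 1)"
  have y: "sum x C = Suc (sum y C)" if "b \<in> C" "finite C" for C
  proof -
    have "sum x C = x b + sum x (C - {b})" using that by (simp add: sum.remove)
    moreover have "sum y C = y b + sum y (C - {b})" using that by (simp add: sum.remove)
    moreover have "sum y (C - {b}) = sum x (C - {b})" by (intro sum.cong) (auto simp: y_def)
    ultimately show ?thesis using b by (simp add: y_def)
  qed
  have "(\<Sum>e\<in>R - {e}. v e) \<le> (\<Sum>b\<in>B. real (y b) * w b)"
  proof (rule Suc.hyps(1))
    show "n = card (R - {e})" using Suc e by simp
    show "finite (R - {e})" using Suc by simp
    fix d assume d: "d \<in> R - {e}"
    \<comment> \<open>Since \<open>v d \<le> v e \<le> w b\<close>, both the removed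
      \<open>e\<close> and the removed unit of \<open>b\<close> count at the threshold of
      \<open>d\<close>, so both sides drop by exactly one.\<close>
    have "{c \<in> R. v d \<le> v c} = insert e {c \<in> R - {e}. v d \<le> v c}" using d e(1) emax[of d] by auto
    then have "card {c \<in> R. v d \<le> v c} = Suc (card {c \<in> R - {e}. v d \<le> v c})"
      using Suc.prems(1) by simp
    moreover have "card {c \<in> R. v d \<le> v c} \<le> (\<Sum>b | b \<in> B \<and> v d \<le> w b. x b)"
      using Suc.prems d by blast
    moreover have "\<dots> = Suc (\<Sum>b | b \<in> B \<and> v d \<le> w b. y b)"
      using b d emax[of d] assms(2) by (intro y) auto
    ultimately show "card {c \<in> R - {e}. v d \<le> v c} \<le> (\<Sum>b | b \<in> B \<and> v d \<le> w b. y b)" by simp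
  qed
  moreover have "(\<Sum>b\<in>B. real (x b) * w b) = (\<Sum>b\<in>B. real (y b) * w b) + w b"
  proof -
    have "(\<Sum>b\<in>B. real (x b) * w b) = real (x b) * w b + (\<Sum>c\<in>B - {b}. real (x c) * w c)"
      using b assms(2) by (simp add: sum.remove)
    moreover have "(\<Sum>b\<in>B. real (y b) * w b) = real (y b) * w b + (\<Sum>c\<in>B - {b}. real (y c) * w c)"
      using b assms(2) by (simp add: sum.remove)
    moreover have "(\<Sum>c\<in>B - {b}. real (y c) * w c) = (\<Sum>c\<in>B - {b}. real (x c) * w c)"
      by (intro sum.cong) (auto simp: y_def)
    ultimately show ?thesis using b by (simp add: y_def algebra_simps of_nat_diff)
  qed
  moreover have "(\<Sum>e\<in>R. v e) = v e + (\<Sum>e\<in>R - {e}. v e)"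
    using Suc.prems e by (simp add: sum.remove)
  ultimately show ?case using b by simp
qed

section \<open>Lower bound from the certificates, and the final orientation\<close>

context edge_greedy
begin

text \<open>An orientation sends the edges spanned by \<open>S\<close> into \<open>S\<close>, where
  each item offers one free copy besides the extra ones; the term \<open>card S\<close> of the
  certificate cancels the free copies. What remains is the threshold condition, with the cost of
  \<open>ext\<close> regrouped as the total weight of \<open>R\<close>.\<close>

lemma greedy_inv_lower_bound:
  assumes inv: "greedy_inv lab cyc ext A R"
    and B: "finite B" "f ` E \<union> g ` E \<subseteq> B" "\<And>b. b \<in> B \<Longrightarrow> 0 \<le> w b"
    and h: "\<And>a. a \<in> E \<Longrightarrow> h a = f a \<or> h a = g a"
    and cap: "\<And>b. b \<in> B \<Longrightarrow> card {a \<in> E. h a = b} \<le> 1 + x b"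
  shows "(\<Sum>b\<in>B. real (ext b) * w b) \<le> (\<Sum>b\<in>B. real (x b) * w b)"
proof -
  have sub: "R \<subseteq> E" using inv by (auto simp: greedy_inv_def)
  have finR: "finite R" using sub finite_E finite_subset by auto
  have ext: "ext b = card {a \<in> R. cheaper a = b}" for b using inv by (auto simp: greedy_inv_def)
  have ch: "cheaper ` R \<subseteq> B" using B(2) sub by (auto simp: cheaper_def)
  have "(\<Sum>b\<in>B. real (ext b) * w b) = (\<Sum>b\<in>B. \<Sum>a\<in>{a \<in> R. cheaper a = b}. weight a)"
    by (intro sum.cong) (auto simp: ext weight_def)
  also have "\<dots> = (\<Sum>a\<in>R. weight a)" using finR B(1) ch by (rule sum.group)
  also have "\<dots> \<le> (\<Sum>b\<in>B. real (x b) * w b)"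
  proof (rule sum_threshold_le[OF finR B(1) B(3)])
    fix e assume "e \<in> R"
    then obtain S where S: "S \<subseteq> f ` E \<union> g ` E" "\<And>b. b \<in> S \<Longrightarrow> weight e \<le> w b"
        "card S + card {d \<in> R. weight e \<le> weight d} \<le> card (spanned S)"
      by (rule greedy_inv_dense_set[OF inv]) blast
    have SB: "S \<subseteq> B" using S(1) B(2) by (rule subset_trans)
    have finS: "finite S" using SB B(1) finite_subset by blast
    have "card (spanned S) \<le> card (\<Union>b\<in>S. {a \<in> E. h a = b})"
      using h finite_E by (intro card_mono finite_UN_I finS) (auto simp: spanned_def)
    also have "\<dots> \<le> (\<Sum>b\<in>S. card {a \<in> E. h a = b})" using finS by (rule card_UN_le)
    also have "\<dots> \<le> (\<Sum>b\<in>S. 1 + x b)" using cap SB by (intro sum_mono) auto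
    also have "\<dots> = card S + sum x S" by (simp only: sum.distrib card_eq_sum)
    finally have "card {d \<in> R. weight e \<le> weight d} \<le> sum x S" using S(3) by simp
    also have "\<dots> \<le> (\<Sum>b | b \<in> B \<and> weight e \<le> w b. x b)"
      using SB S(2) B(1) by (intro sum_mono2) auto
    finally show "card {d \<in> R. weight e \<le> weight d} \<le> (\<Sum>b | b \<in> B \<and> weight e \<le> w b. x b)" .
  qed auto
  finally show ?thesis .
qed

text \<open>The last property says that no copy of an item with extra copies is idle. If
  \<open>0 < ext b\<close>, then \<open>b\<close> is an endpoint of a rejected edge and so lies in a
  cyclic component; accepted edges and vertices are equally many there, so an injective orientation
  is onto and hits \<open>b\<close>. The rejected edges paying for \<open>b\<close> add exactly
  \<open>ext b\<close>.\<close>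

lemma greedy_inv_orientation:
  assumes inv: "greedy_inv lab cyc ext A R" and E: "A \<union> R = E"
  obtains h where "\<And>a. a \<in> E \<Longrightarrow> h a = f a \<or> h a = g a"
    and "\<And>b. card {a \<in> E. h a = b} \<le> 1 + ext b"
    and "\<And>b. 0 < ext b \<Longrightarrow> card {a \<in> E. h a = b} = 1 + ext b"
proof -
  have sub: "A \<subseteq> E" "R \<subseteq> E" "A \<inter> R = {}" using inv by (auto simp: greedy_inv_def)
  have fin: "finite A" "finite R" using sub finite_E by (auto intro: finite_subset)
  have ext: "ext b = card {a \<in> R. cheaper a = b}" for b using inv by (auto simp: greedy_inv_def)
  have Alab: "lab (f a) = lab (g a)" if "a \<in> A" for a
    using inv that by (auto simp: greedy_inv_def)
  have cnt: "card {a \<in> A. lab (f a) = c} + (if cyc c then 0 else 1) = card {b \<in> V. lab b = c}"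
    if "c \<in> lab ` V" for c
    using inv that by (auto simp: greedy_inv_def)
  have Rcyc: "cyc (lab (f a)) \<and> cyc (lab (g a))" if "a \<in> R" for a
    using inv that by (auto simp: greedy_inv_def)
  obtain h0 where h0: "inj_on h0 A" "\<forall>a\<in>A. h0 a = f a \<or> h0 a = g a"
    using greedy_inv_orient_avoiding[OF inv, of "{}"] by auto
  define h where "h a = (if a \<in> A then h0 a else cheaper a)" for a
  have split: "{a \<in> E. h a = b} = {a \<in> A. h0 a = b} \<union> {a \<in> R. cheaper a = b}" for b
    using E sub by (auto simp: h_def)
  have card_split: "card {a \<in> E. h a = b} = card {a \<in> A. h0 a = b} + ext b" for b
    unfolding split ext using fin sub by (intro card_Un_disjoint) auto
  have le1: "card {a \<in> A. h0 a = b} \<le> 1" for b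
    unfolding card_le_Suc0_iff_eq[OF finite_subset[OF _ fin(1)], of "{a \<in> A. h0 a = b}", simplified]
      One_nat_def using h0(1) by (auto simp: inj_on_def)
  show thesis
  proof
    show "h a = f a \<or> h a = g a" if "a \<in> E" for a
      using h0 by (auto simp: h_def cheaper_def)
    show "card {a \<in> E. h a = b} \<le> 1 + ext b" for b
      using le1[of b] card_split[of b] by simp
    fix b assume b: "0 < ext b"
    then have "{a \<in> R. cheaper a = b} \<noteq> {}" by (metis ext card.empty less_irrefl)
    then obtain r where r: "r \<in> R" "cheaper r = b" by auto
    have bc: "cyc (lab b)" "b \<in> V"
      using r Rcyc[of r] f_V[of r] g_V[of r] subsetD[OF sub(2), of r] by (auto simp: cheaper_def split: if_splits)
    let ?A = "{a \<in> A. lab (f a) = lab b}"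
    have sub': "h0 ` ?A \<subseteq> {b' \<in> V. lab b' = lab b}"
    proof
      fix y assume "y \<in> h0 ` ?A"
      then obtain a where a: "a \<in> A" "lab (f a) = lab b" "y = h0 a" by auto
      have "f a \<in> V" "g a \<in> V" using a(1) sub(1) f_V g_V by blast+
      moreover have "lab (f a) = lab b" "lab (g a) = lab b" using a Alab[of a] by simp_all
      moreover have "y = f a \<or> y = g a" using a h0(2) by simp
      ultimately show "y \<in> {b' \<in> V. lab b' = lab b}" by (elim disjE) simp_all
    qed
    have "card (h0 ` ?A) = card ?A" using h0(1) by (intro card_image) (auto simp: inj_on_def)
    also have "\<dots> = card {b' \<in> V. lab b' = lab b}"
      using cnt[OF imageI[OF bc(2)]] bc(1) by (simp only: if_True add_0_right)
    finally have card_eq: "card (h0 ` ?A) = card {b' \<in> V. lab b' = lab b}" .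
    have "finite {b' \<in> V. lab b' = lab b}" using finite_V by simp
    then have "h0 ` ?A = {b' \<in> V. lab b' = lab b}" using sub' card_eq by (rule card_subset_eq)
    moreover have "b \<in> {b' \<in> V. lab b' = lab b}" using bc by simp
    ultimately have "b \<in> h0 ` ?A" by (simp only:)
    then obtain a where "a \<in> A" "h0 a = b" by blast
    then have "{a \<in> A. h0 a = b} \<noteq> {}" by auto
    then have "card {a \<in> A. h0 a = b} \<noteq> 0" using fin by simp
    then show "card {a \<in> E. h a = b} = 1 + ext b"
      using le1[of b] card_split[of b] by simp
  qed
qed

end

section \<open>Popular matchings for lists of length at most two\<close>

text \<open>\<open>f\<close> and \<open>g\<close> are total because they will be read from memory;
  beyond \<open>len a\<close> their values are unconstrained, hence the guards on \<open>len\<close>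
  in the definitions below.\<close>

locale short_lists =
  fixes G :: "('a, 'b) pref_instance" and len :: "'a \<Rightarrow> nat" and f g :: "'a \<Rightarrow> 'b"
  assumes pref_inst: "preference_instance G"
    and acceptable: "a \<in> people G \<Longrightarrow>
      acceptable G a = (if len a = 0 then {} else if len a = 1 then {f a} else {f a, g a})"
    and rank: "a \<in> people G \<Longrightarrow> 1 < len a \<Longrightarrow> rank G a (f a) < rank G a (g a)"
begin

definition first_choices :: "'b set" where
  "first_choices = f ` {a \<in> people G. 0 < len a}"

definition contested :: "'a set" where
  "contested = {a \<in> people G. 1 < len a \<and> g a \<notin> first_choices}"

lemma finite_people: "finite (people G)" and finite_items: "finite (items G)"
  using pref_inst by (auto simp: preference_instance_def)

lemma acceptable_items: "b \<in> acceptable G a \<Longrightarrow> b \<in> items G"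
  using pref_inst by (auto simp: preference_instance_def acceptable_def)

lemma contested_people: "contested \<subseteq> people G"
  by (auto simp: contested_def)

lemma f_contested: "a \<in> contested \<Longrightarrow> f a \<in> first_choices"
  and g_contested: "a \<in> contested \<Longrightarrow> g a \<notin> first_choices"
  by (auto simp: contested_def first_choices_def)

lemma acceptable_contested: "a \<in> contested \<Longrightarrow> acceptable G a = {f a, g a}"
  by (auto simp: contested_def acceptable)

lemma first_choices_items: "first_choices \<subseteq> items G"
proof
  fix b assume "b \<in> first_choices"
  then obtain a where "a \<in> people G" "0 < len a" "b = f a" by (auto simp: first_choices_def)
  then have "b \<in> acceptable G a" by (auto simp: acceptable)
  then show "b \<in> items G" by (rule acceptable_items)
qed

section \<open>Popularity and the contested persons\<close>

lemma matching_update: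
  assumes M: "matching G M" and a: "a \<in> people G" and b: "b \<in> acceptable G a"
    and free: "card {x \<in> people G. x \<noteq> a \<and> M x = Some b} < copies G b"
  shows "matching G (M(a \<mapsto> b))"
proof -
  have "card {x \<in> people G. (M(a \<mapsto> b)) x = Some c} \<le> copies G c" if c: "c \<in> items G" for c
  proof (cases "c = b")
    case True
    have "{x \<in> people G. (M(a \<mapsto> b)) x = Some c} = insert a {x \<in> people G. x \<noteq> a \<and> M x = Some b}"
      using a True by auto
    then show ?thesis using free finite_people True by simp
  next
    case False
    have "card {x \<in> people G. (M(a \<mapsto> b)) x = Some c} \<le> card {x \<in> people G. M x = Some c}"
      using finite_people False by (intro card_mono) auto
    also have "\<dots> \<le> copies G c" using M c by (auto simp: matching_def)
    finally show ?thesis .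
  qed
  then show ?thesis using M a b by (auto simp: matching_def)
qed

lemma matching_remove:
  assumes "matching G M"
  shows "matching G (M(a := None))"
proof -
  have "card {x \<in> people G. (M(a := None)) x = Some c} \<le> copies G c" if c: "c \<in> items G" for c
  proof -
    have "card {x \<in> people G. (M(a := None)) x = Some c} \<le> card {x \<in> people G. M x = Some c}"
      using finite_people by (intro card_mono) auto
    also have "\<dots> \<le> copies G c" using assms c by (auto simp: matching_def)
    finally show ?thesis .
  qed
  then show ?thesis using assms by (auto simp: matching_def)
qed

text \<open>An unmatched contested person could take her second choice from somebody who is promoted to
  her own first choice; this costs at most one other person.\<close>

lemma popular_matches_contested:
  assumes pop: "popular G M" and copies: "\<And>b. b \<in> items G \<Longrightarrow> 1 \<le> copies G b"
    and a: "a \<in> contested"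
  shows "M a \<noteq> None"
proof
  assume Ma: "M a = None"
  have M: "matching G M" using pop by (simp add: popular_def)
  have aP: "a \<in> people G" using a contested_people by auto
  have ga: "g a \<in> acceptable G a" using acceptable_contested[OF a] by simp
  then have ga_item: "g a \<in> items G" by (rule acceptable_items)
  have card_le: "card {x \<in> people G. M x = Some b} \<le> copies G b" if "b \<in> items G" for b
    using M that by (simp add: matching_def)
  have no_gain: "\<not> more_popular G M' M" if "matching G M'" for M'
    using pop that by (auto simp: popular_def)
  show False
  proof (cases "card {x \<in> people G. M x = Some (g a)} < copies G (g a)")
    case True
    have "card {x \<in> people G. x \<noteq> a \<and> M x = Some (g a)} \<le> card {x \<in> people G. M x = Some (g a)}"
      using finite_people by (intro card_mono) auto
    with True have "matching G (M(a \<mapsto> g a))" using M aP ga by (intro matching_update) auto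
    moreover have "{x \<in> people G. prefers G x (M(a \<mapsto> g a)) M} = {a}"
      using aP Ma by (auto simp: prefers_def split: option.splits if_splits)
    moreover have "{x \<in> people G. prefers G x M (M(a \<mapsto> g a))} = {}"
      using aP Ma by (auto simp: prefers_def split: option.splits if_splits)
    ultimately show False using no_gain[of "M(a \<mapsto> g a)"] unfolding more_popular_def by (simp only: card.empty) simp
  next
    case full: False
    \<comment> \<open>\<open>g a\<close> is full and has at least one copy, so somebody holds it. As
      it is nobody's first choice, it is the second choice of the holder \<open>a1\<close>, who
      gains by moving to \<open>f a1\<close>.\<close>
    then have "card {x \<in> people G. M x = Some (g a)} \<noteq> 0" using copies[OF ga_item] by auto
    then have "{x \<in> people G. M x = Some (g a)} \<noteq> {}" by (metis card.empty)
    then obtain a1 where a1: "a1 \<in> people G" "M a1 = Some (g a)" by auto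
    have "g a \<in> acceptable G a1" using M a1 by (simp add: matching_def)
    moreover have "f a1 \<noteq> g a" if "0 < len a1"
      using that a1(1) g_contested[OF a] by (metis (mono_tags, lifting) first_choices_def imageI mem_Collect_eq)
    ultimately have len1: "1 < len a1" and g1: "g a1 = g a" and f1: "f a1 \<noteq> g a" "f a1 \<in> acceptable G a1"
      using a1(1) by (auto simp: acceptable split: if_splits)
    have f1_item: "f a1 \<in> items G" using f1(2) by (rule acceptable_items)
    \<comment> \<open>\<open>M0\<close> has room at \<open>f a1\<close>, at the expense of at most
      the person \<open>a2\<close>. If there is room already, \<open>M0\<close> is \<open>M\<close>
      and \<open>a2\<close> is arbitrary.\<close>
    have "\<exists>a2 M0. matching G M0 \<and> (\<forall>x. x \<noteq> a2 \<longrightarrow> M0 x = M x) \<and> M0 a = None \<and> M0 a1 = Some (g a) \<and>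
        card {x \<in> people G. M0 x = Some (f a1)} < copies G (f a1)"
    proof (cases "card {x \<in> people G. M x = Some (f a1)} < copies G (f a1)")
      case True
      then show ?thesis using M Ma a1 by auto
    next
      case False
      then have "card {x \<in> people G. M x = Some (f a1)} \<noteq> 0" using copies[OF f1_item] by auto
      then have "{x \<in> people G. M x = Some (f a1)} \<noteq> {}" by (metis card.empty)
      then obtain a2 where a2: "a2 \<in> people G" "M a2 = Some (f a1)" by auto
      have "{x \<in> people G. (M(a2 := None)) x = Some (f a1)} \<subset> {x \<in> people G. M x = Some (f a1)}"
        using a2 by auto
      then have "card {x \<in> people G. (M(a2 := None)) x = Some (f a1)} < card {x \<in> people G. M x = Some (f a1)}"
        using finite_people by (intro psubset_card_mono) auto
      then show ?thesis
        using matching_remove[OF M, of a2] a2 a1 f1 Ma card_le[OF f1_item]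
        by (intro exI[of _ a2] exI[of _ "M(a2 := None)"]) auto
    qed
    then obtain a2 M0 where M0: "matching G M0" "\<And>x. x \<noteq> a2 \<Longrightarrow> M0 x = M x" "M0 a = None"
        "M0 a1 = Some (g a)" "card {x \<in> people G. M0 x = Some (f a1)} < copies G (f a1)" by blast
    define M' where "M' = M0(a1 \<mapsto> f a1, a \<mapsto> g a)"
    have "card {x \<in> people G. x \<noteq> a1 \<and> M0 x = Some (f a1)} \<le> card {x \<in> people G. M0 x = Some (f a1)}"
      using finite_people by (intro card_mono) auto
    then have M1: "matching G (M0(a1 \<mapsto> f a1))"
      using M0 a1 f1 by (intro matching_update) auto
    have "{x \<in> people G. x \<noteq> a \<and> (M0(a1 \<mapsto> f a1)) x = Some (g a)} \<subset> {x \<in> people G. M0 x = Some (g a)}"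
      using a1 M0 f1 by (auto split: if_splits)
    then have "card {x \<in> people G. x \<noteq> a \<and> (M0(a1 \<mapsto> f a1)) x = Some (g a)} <
        card {x \<in> people G. M0 x = Some (g a)}"
      using finite_people by (intro psubset_card_mono) auto
    also have "\<dots> \<le> copies G (g a)" using M0(1) ga_item by (simp add: matching_def)
    finally have M': "matching G M'"
      unfolding M'_def by (rule matching_update[OF M1 aP ga])
    have ne: "a \<noteq> a1" using Ma a1 by auto
    have "{x \<in> people G. prefers G x M M'} \<subseteq> {a2}"
    proof
      fix x assume x: "x \<in> {x \<in> people G. prefers G x M M'}"
      have "\<not> prefers G a M M'" using Ma by (simp add: prefers_def)
      moreover have "\<not> prefers G a1 M M'"
        using a1 ne rank[OF a1(1) len1] g1 by (simp add: prefers_def M'_def)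
      moreover have "\<not> prefers G x M M'" if "x \<notin> {a, a1, a2}"
        using that M0(2) by (simp add: prefers_def M'_def split: option.splits)
      ultimately show "x \<in> {a2}" using x by auto
    qed
    then have "card {x \<in> people G. prefers G x M M'} \<le> card {a2}" by (intro card_mono) auto
    moreover have "{a, a1} \<subseteq> {x \<in> people G. prefers G x M' M}"
      using aP Ma a1 ne rank[OF a1(1) len1] g1 by (auto simp: prefers_def M'_def)
    then have "card {a, a1} \<le> card {x \<in> people G. prefers G x M' M}"
      using finite_people by (intro card_mono) auto
    ultimately have "more_popular G M' M" using ne by (simp add: more_popular_def)
    with no_gain[OF M'] show False by simp
  qed
qed

text \<open>First choices are filled up with people who rank them first; then any gain in a first
  choice is compensated by somebody who loses hers.\<close>

lemma popular_of_assignment: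
  assumes h: "\<And>a. a \<in> contested \<Longrightarrow> h a = f a \<or> h a = g a"
    and cap: "\<And>b. b \<in> items G \<Longrightarrow> card {a \<in> contested. h a = b} \<le> copies G b"
    and filled: "\<And>b. b \<in> first_choices \<Longrightarrow> copies G b \<le> card {a \<in> people G. 0 < len a \<and> f a = b}"
  shows "admits_popular_matching G"
proof -
  have finC: "finite contested" using contested_people finite_people finite_subset by auto
  \<comment> \<open>\<open>T\<close> will be the set of people holding the first choice
    \<open>b\<close>: those assigned \<open>b\<close> by \<open>h\<close>, enlarged by others
    ranking \<open>b\<close> first until all copies are used, which \<open>filled\<close> makes
    possible.\<close>
  have "\<exists>T. {a \<in> contested. h a = b} \<subseteq> T \<and> T \<subseteq> {a \<in> people G. 0 < len a \<and> f a = b} \<and> card T = copies G b"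
    if b: "b \<in> first_choices" for b
  proof -
    have sub: "{a \<in> contested. h a = b} \<subseteq> {a \<in> people G. 0 < len a \<and> f a = b}"
    proof
      fix a assume "a \<in> {a \<in> contested. h a = b}"
      then have "a \<in> contested" "h a = b" by auto
      moreover from this have "h a = f a" using h[of a] g_contested[of a] b by auto
      ultimately show "a \<in> {a \<in> people G. 0 < len a \<and> f a = b}" by (auto simp: contested_def)
    qed
    have "card {a \<in> contested. h a = b} \<le> copies G b" using cap b first_choices_items by auto
    from exists_subset_between[OF this filled[OF b] sub] finite_people show ?thesis by auto
  qed
  then have "\<forall>b\<in>first_choices. \<exists>T. {a \<in> contested. h a = b} \<subseteq> T \<and>
      T \<subseteq> {a \<in> people G. 0 < len a \<and> f a = b} \<and> card T = copies G b" by blast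
  from bchoice[OF this] obtain T where T: "\<And>b. b \<in> first_choices \<Longrightarrow> {a \<in> contested. h a = b} \<subseteq> T b"
      "\<And>b. b \<in> first_choices \<Longrightarrow> T b \<subseteq> {a \<in> people G. 0 < len a \<and> f a = b}"
      "\<And>b. b \<in> first_choices \<Longrightarrow> card (T b) = copies G b" by blast
  \<comment> \<open>A contested person not chosen for \<open>T (f a)\<close> was assigned
    \<open>g a\<close> by \<open>h\<close>, so the second choices handed out here respect the
    capacities.\<close>
  define M where "M a = (if a \<in> people G \<and> 0 < len a \<and> a \<in> T (f a) then Some (f a)
      else if a \<in> contested then Some (g a) else None)" for a
  have fF: "f a \<in> first_choices" if "a \<in> people G" "0 < len a" for a
    using that by (auto simp: first_choices_def)
  have M_first: "{a \<in> people G. M a = Some b} = T b" if b: "b \<in> first_choices" for b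
  proof -
    have "g a \<noteq> b" if "a \<in> contested" for a using g_contested[OF that] b by metis
    then show ?thesis using T(2)[OF b] by (auto simp: M_def split: if_splits)
  qed
  have M_other: "{a \<in> people G. M a = Some b} \<subseteq> {a \<in> contested. h a = b}" if b: "b \<notin> first_choices" for b
  proof
    fix a assume a: "a \<in> {a \<in> people G. M a = Some b}"
    then have ac: "a \<in> contested" "g a = b" "a \<notin> T (f a)"
      using b fF contested_people by (auto simp: M_def contested_def split: if_splits)
    then have "h a \<noteq> f a" using T(1)[OF f_contested[OF ac(1)]] by auto
    with h[OF ac(1)] ac show "a \<in> {a \<in> contested. h a = b}" by auto
  qed
  have M: "matching G M"
    unfolding matching_def
  proof (intro conjI allI impI ballI)
    show "dom M \<subseteq> people G" using contested_people by (auto simp: M_def split: if_splits)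
    show "b \<in> acceptable G a" if "M a = Some b" for a b
      using that acceptable_contested[of a] by (auto simp: M_def acceptable split: if_splits)
    show "card {a \<in> people G. M a = Some b} \<le> copies G b" if "b \<in> items G" for b
    proof (cases "b \<in> first_choices")
      case True
      then show ?thesis using M_first T(3) by simp
    next
      case False
      have "card {a \<in> people G. M a = Some b} \<le> card {a \<in> contested. h a = b}"
        using M_other[OF False] finC by (intro card_mono) auto
      with cap[OF that] show ?thesis by simp
    qed
  qed
  have "\<not> more_popular G M' M" if M': "matching G M'" for M'
  proof -
    define X where "X b = {a \<in> people G. M' a = Some b \<and> M a \<noteq> Some b}" for b
    define Y where "Y b = {a \<in> people G. M a = Some b \<and> M' a \<noteq> Some b}" for b
    have finF: "finite first_choices" using first_choices_items finite_items finite_subset by auto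
    have finXY: "finite (X b)" "finite (Y b)" for b using finite_people by (auto simp: X_def Y_def)
    \<comment> \<open>\<open>M\<close> uses every copy of the first choice \<open>b\<close>, so each
      newcomer at \<open>b\<close> in \<open>M'\<close> displaces somebody.\<close>
    have XY: "card (X b) \<le> card (Y b)" if b: "b \<in> first_choices" for b
    proof -
      let ?Z = "{a \<in> people G. M' a = Some b \<and> M a = Some b}"
      have "card (X b) + card ?Z = card {a \<in> people G. M' a = Some b}"
        using finite_people unfolding X_def
        by (subst card_Un_disjoint[symmetric]) (auto intro!: arg_cong[where f = card])
      also have "\<dots> \<le> copies G b" using M' b first_choices_items by (auto simp: matching_def)
      also have "\<dots> = card {a \<in> people G. M a = Some b}" using M_first[OF b] T(3)[OF b] by simp
      also have "\<dots> = card (Y b) + card ?Z"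
        using finite_people unfolding Y_def
        by (subst card_Un_disjoint[symmetric]) (auto intro!: arg_cong[where f = card])
      finally show ?thesis by simp
    qed
    have "{a \<in> people G. prefers G a M' M} \<subseteq> (\<Union>b\<in>first_choices. X b)"
    proof
      fix a assume "a \<in> {a \<in> people G. prefers G a M' M}"
      then have a: "a \<in> people G" and pr: "prefers G a M' M" by auto
      then obtain b where b: "M' a = Some b" by (auto simp: prefers_def split: option.splits)
      have Mb: "M a \<noteq> Some b" using pr b by (auto simp: prefers_def)
      have acc: "b \<in> acceptable G a" using M' b by (simp add: matching_def)
      \<comment> \<open>A gain outside the first choices is impossible: it would lead to the second
        choice of a contested person, who has at least that in \<open>M\<close>.\<close>
      have "b \<in> first_choices"
      proof (cases "b = f a")
        case True
        then show ?thesis using acc a fF by (auto simp: acceptable split: if_splits)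
      next
        case False
        then have l: "1 < len a" and bg: "b = g a" using acc a by (auto simp: acceptable split: if_splits)
        have nf: "M a \<noteq> Some (f a)" using pr b bg rank[OF a l] by (auto simp: prefers_def)
        have "a \<notin> T (f a)" using nf a l by (auto simp: M_def)
        then have "a \<notin> contested" using Mb bg by (auto simp: M_def)
        then show ?thesis using a l bg by (auto simp: contested_def)
      qed
      then show "a \<in> (\<Union>b\<in>first_choices. X b)" using a b Mb by (auto simp: X_def)
    qed
    then have "card {a \<in> people G. prefers G a M' M} \<le> card (\<Union>b\<in>first_choices. X b)"
      using finF finXY by (intro card_mono) auto
    also have "\<dots> \<le> (\<Sum>b\<in>first_choices. card (X b))" using finF by (rule card_UN_le)
    also have "\<dots> \<le> (\<Sum>b\<in>first_choices. card (Y b))" using XY by (rule sum_mono)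
    \<comment> \<open>The sets \<open>Y b\<close> are disjoint because \<open>M a\<close> determines
      \<open>b\<close>. Whoever leaves \<open>b\<close> gives up her own first choice and therefore
      prefers \<open>M\<close>.\<close>
    also have "\<dots> = card (\<Union>b\<in>first_choices. Y b)"
      using finF finXY by (intro card_UN_disjoint[symmetric]) (auto simp: Y_def)
    also have "\<dots> \<le> card {a \<in> people G. prefers G a M M'}"
    proof (intro card_mono subsetI)
      show "finite {a \<in> people G. prefers G a M M'}" using finite_people by simp
      fix a assume "a \<in> (\<Union>b\<in>first_choices. Y b)"
      then obtain b where b: "b \<in> first_choices" "a \<in> people G" "M a = Some b" "M' a \<noteq> Some b"
        by (auto simp: Y_def)
      then have "a \<in> T b" using M_first[OF b(1)] by auto
      then have l: "0 < len a" and fa: "f a = b" using T(2)[OF b(1)] by auto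
      have "rank G a (f a) < rank G a c" if c: "M' a = Some c" for c
      proof -
        have "c \<in> acceptable G a" using M' c by (simp add: matching_def)
        then show ?thesis using b fa c rank[OF b(2)] by (auto simp: acceptable split: if_splits)
      qed
      then show "a \<in> {a \<in> people G. prefers G a M M'}"
        using b fa by (auto simp: prefers_def split: option.splits)
    qed
    finally show ?thesis by (simp add: more_popular_def)
  qed
  with M show ?thesis by (auto simp: admits_popular_matching_def popular_def)
qed

end

section \<open>From preference instances to oriented multigraphs\<close>

lemma pref_list_short:
  assumes "finite (acceptable G a)" and inj: "inj_on (rank G a) (acceptable G a)"
    and card: "card (acceptable G a) \<le> 2"
  defines "L \<equiv> pref_list G a"
  shows "acceptable G a = (if length L = 0 then {} else if length L = 1 then {L ! 0} else {L ! 0, L ! 1})"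
    and "1 < length L \<Longrightarrow> rank G a (L ! 0) < rank G a (L ! 1)"
proof -
  define R where "R = sorted_list_of_set (rank G a ` acceptable G a)"
  have L: "L = map (inv_into (acceptable G a) (rank G a)) R" by (simp add: L_def pref_list_def R_def)
  have setR: "set R = rank G a ` acceptable G a" using assms(1) by (simp add: R_def)
  have setL: "set L = acceptable G a" using setR inj by (simp add: L image_comp)
  have len: "length L = card (acceptable G a)"
    using inj by (simp add: L R_def card_image)
  have l2: "length L \<le> 2" using len card by simp
  have "length L = 0 \<or> length L = 1 \<or> length L = 2" using l2 by linarith
  then show "acceptable G a = (if length L = 0 then {} else if length L = 1 then {L ! 0} else {L ! 0, L ! 1})"
    unfolding setL[symmetric] by (auto simp: length_Suc_conv numeral_2_eq_2)
  show "rank G a (L ! 0) < rank G a (L ! 1)" if "1 < length L"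
  proof -
    have r: "rank G a (L ! i) = R ! i" if "i < length R" for i
      using that setR nth_mem[OF that] by (simp add: L f_inv_into_f)
    have "sorted_wrt (<) R" by (simp add: R_def)
    then have "R ! 0 < R ! 1" using that by (simp add: L sorted_wrt_iff_nth_less)
    moreover have "length R = length L" by (simp add: L)
    ultimately show ?thesis using r[of 0] r[of 1] that by (cases "L = []") auto
  qed
qed

lemma short_lists_augment:
  assumes "short_lists G len f g"
  shows "short_lists (augment G k) len f g"
  using assms by (simp add: short_lists_def preference_instance_def acceptable_def augment_def)

text \<open>Being contested does not depend on the number of copies, so a popular matching of any
  augmented instance is an orientation within the capacities of that instance, and the lower bound
  applies to it. Costs are summed over \<open>items G\<close> and not over \<open>V\<close>, which
  may contain a default entry that is no item.\<close>

lemma min_cost_augmentation_greedy: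
  fixes G :: "(nat, nat) pref_instance"
  assumes short: "short_lists G len f g" and input: "augmentation_input G cost"
    and V: "finite V" "f ` short_lists.contested G len f g \<union> g ` short_lists.contested G len f g \<subseteq> V"
    and inv: "edge_greedy.greedy_inv f g (short_lists.contested G len f g) V cost lab cyc ext A R"
    and all: "A \<union> R = short_lists.contested G len f g"
  shows "min_cost_augmentation G cost ext"
proof -
  interpret short_lists G len f g by (rule short)
  interpret edge_greedy f g contested V cost
    using V finite_subset[OF contested_people finite_people] by unfold_locales auto
  have fin: "finite contested" using finite_E .
  have items: "f ` contested \<union> g ` contested \<subseteq> items G"
    using acceptable_contested acceptable_items by blast
  have copies1: "copies G b = 1" and cost0: "0 \<le> cost b" if "b \<in> items G" for b
    using input that by (auto simp: augmentation_input_def)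
  have aug: "people (augment G k) = people G" "items (augment G k) = items G"
    "copies (augment G k) b = copies G b + k b" "acceptable (augment G k) a = acceptable G a" for k a b
    by (simp_all add: augment_def acceptable_def)
  have cont: "short_lists.contested (augment G k) len f g = contested"
    "short_lists.first_choices (augment G k) len f = first_choices" for k
    using short_lists.contested_def[OF short_lists_augment[OF short], of k]
      short_lists.first_choices_def[OF short_lists_augment[OF short], of k]
    by (simp_all add: aug contested_def first_choices_def)
  obtain h where h: "\<And>a. a \<in> contested \<Longrightarrow> h a = f a \<or> h a = g a"
    "\<And>b. card {a \<in> contested. h a = b} \<le> 1 + ext b"
    "\<And>b. 0 < ext b \<Longrightarrow> card {a \<in> contested. h a = b} = 1 + ext b"
    by (rule greedy_inv_orientation[OF inv all]) blast
  have "admits_popular_matching (augment G ext)"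
  proof (rule short_lists.popular_of_assignment[OF short_lists_augment[OF short]], unfold cont aug)
    show "h a = f a \<or> h a = g a" if "a \<in> contested" for a using h that by simp
    show "card {a \<in> contested. h a = b} \<le> copies G b + ext b" if "b \<in> items G" for b
      using h(2) copies1[OF that] by simp
    fix b assume b: "b \<in> first_choices"
    then have c: "copies G b = 1" using copies1 first_choices_items by auto
    show "copies G b + ext b \<le> card {a \<in> people G. 0 < len a \<and> f a = b}"
    proof (cases "ext b = 0")
      case True
      obtain a where "a \<in> people G" "0 < len a" "f a = b" using b by (auto simp: first_choices_def)
      then have "{a \<in> people G. 0 < len a \<and> f a = b} \<noteq> {}" by auto
      then have "card {a \<in> people G. 0 < len a \<and> f a = b} \<noteq> 0" using finite_people by simp
      then show ?thesis using c True by simp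
    next
      case False
      \<comment> \<open>Contested persons assigned the first choice \<open>b\<close> rank it first,
        since their second choices are no first choices; they number exactly
        \<open>1 + ext b\<close>.\<close>
      have "h a = f a" if "a \<in> contested" "h a = b" for a
        using h(1)[OF that(1)] g_contested[OF that(1)] b that by auto
      then have "card {a \<in> contested. h a = b} \<le> card {a \<in> people G. 0 < len a \<and> f a = b}"
        using finite_people by (intro card_mono) (auto simp: contested_def)
      then show ?thesis using h(3)[of b] False c by simp
    qed
  qed
  moreover have "augmentation_cost G cost ext \<le> augmentation_cost G cost k"
    if k: "admits_popular_matching (augment G k)" for k
  proof -
    obtain M where M: "popular (augment G k) M" using k by (auto simp: admits_popular_matching_def)
    have Mm: "matching (augment G k) M" using M by (simp add: popular_def)
    have some: "M a \<noteq> None" if "a \<in> contested" for a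
      using short_lists.popular_matches_contested[OF short_lists_augment[OF short] M, unfolded cont aug]
        that copies1 by simp
    define h where "h a = the (M a)" for a
    show ?thesis unfolding augmentation_cost_def
    proof (rule greedy_inv_lower_bound[OF inv finite_items items cost0])
      fix a assume a: "a \<in> contested"
      then obtain b where "M a = Some b" using some by auto
      then show "h a = f a \<or> h a = g a"
        using Mm acceptable_contested[OF a] by (auto simp: matching_def aug h_def)
    next
      fix b assume b: "b \<in> items G"
      have "card {a \<in> contested. h a = b} \<le> card {a \<in> people G. M a = Some b}"
        using some finite_people contested_people by (intro card_mono) (auto simp: h_def)
      also have "\<dots> \<le> copies G b + k b" using Mm b by (simp add: matching_def aug)
      also have "\<dots> = 1 + k b" using copies1[OF b] by simp
      finally show "card {a \<in> contested. h a = b} \<le> 1 + k b" .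
    qed simp
  qed
  ultimately show ?thesis by (simp add: min_cost_augmentation_def)
qed

section \<open>Loops of the random access machine\<close>

text \<open>The time is only bounded from above, so that the two branches of a conditional can share
  one budget.\<close>

definition halts :: "com \<Rightarrow> state \<Rightarrow> nat \<Rightarrow> (state \<Rightarrow> bool) \<Rightarrow> bool" where
  "halts c s t Q \<longleftrightarrow> (\<exists>u s'. exec c s u s' \<and> u \<le> t \<and> Q s')"

lemma halts_mono:
  "halts c s t Q \<Longrightarrow> t \<le> t' \<Longrightarrow> (\<And>s'. Q s' \<Longrightarrow> Q' s') \<Longrightarrow> halts c s t' Q'"
  unfolding halts_def by (meson order_trans)

lemma halts_Seq:
  "halts c s t Q \<Longrightarrow> (\<And>s'. Q s' \<Longrightarrow> halts c' s' t' R) \<Longrightarrow> halts (Seq c c') s (t + t') R"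
  unfolding halts_def by (meson add_mono exec.Seq)

lemma halts_Cond:
  "(bval b s \<Longrightarrow> halts c s t Q) \<Longrightarrow> (\<not> bval b s \<Longrightarrow> halts c' s t Q) \<Longrightarrow>
    halts (Cond b c c') s (1 + btime b + t) Q"
  unfolding halts_def by (meson add_left_mono exec.CondFalse exec.CondTrue)

primrec loop_free :: "com \<Rightarrow> bool" where
  "loop_free Skip \<longleftrightarrow> True"
| "loop_free (NWrite x i e) \<longleftrightarrow> True"
| "loop_free (RWrite x i e) \<longleftrightarrow> True"
| "loop_free (Seq c c') \<longleftrightarrow> loop_free c \<and> loop_free c'"
| "loop_free (Cond b c c') \<longleftrightarrow> loop_free c \<and> loop_free c'"
| "loop_free (While b c) \<longleftrightarrow> False"

text \<open>The equations for \<open>While\<close> are junk: both functions are only used on loop-free programs.\<close>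

primrec run :: "com \<Rightarrow> state \<Rightarrow> state" where
  "run Skip s = s"
| "run (NWrite x i e) s = nwrite x (nval i s) (nval e s) s"
| "run (RWrite x i e) s = rwrite x (nval i s) (rval e s) s"
| "run (Seq c c') s = run c' (run c s)"
| "run (Cond b c c') s = (if bval b s then run c s else run c' s)"
| "run (While b c) s = s"

primrec ctime :: "com \<Rightarrow> nat" where
  "ctime Skip = 1"
| "ctime (NWrite x i e) = 1 + ntime i + ntime e"
| "ctime (RWrite x i e) = 1 + ntime i + rtime e"
| "ctime (Seq c c') = ctime c + ctime c'"
| "ctime (Cond b c c') = 1 + btime b + max (ctime c) (ctime c')"
| "ctime (While b c) = 0"

lemma halts_loop_free: "loop_free c \<Longrightarrow> halts c s (ctime c) (\<lambda>s'. s' = run c s)"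
proof (induction c arbitrary: s)
  case (Seq c c')
  have "halts c s (ctime c) (\<lambda>s'. s' = run c s)" using Seq by simp
  moreover have "halts c' s' (ctime c') (\<lambda>s''. s'' = run (Seq c c') s)" if "s' = run c s" for s'
    using Seq that by simp
  ultimately show ?case by (simp add: halts_Seq)
next
  case (Cond b c c')
  have "halts (Cond b c c') s (1 + btime b + max (ctime c) (ctime c')) (\<lambda>s'. s' = run (Cond b c c') s)"
  proof (rule halts_Cond)
    assume "bval b s"
    then show "halts c s (max (ctime c) (ctime c')) (\<lambda>s'. s' = run (Cond b c c') s)"
      using Cond by (intro halts_mono[OF Cond.IH(1)]) auto
  next
    assume "\<not> bval b s"
    then show "halts c' s (max (ctime c) (ctime c')) (\<lambda>s'. s' = run (Cond b c c') s)"
      using Cond by (intro halts_mono[OF Cond.IH(2)]) auto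
  qed
  then show ?case by simp
qed (auto simp: halts_def intro: exec.intros)

lemma halts_run: "loop_free c \<Longrightarrow> Q (run c s) \<Longrightarrow> halts c s (ctime c) Q"
  using halts_loop_free by (rule halts_mono) auto

abbreviation cell :: "string \<Rightarrow> nexp" where
  "cell x \<equiv> NCell x (Num 0)"

abbreviation entry :: "string \<Rightarrow> string \<Rightarrow> nexp" where
  "entry x i \<equiv> NCell x (cell i)"

definition for_people :: "string \<Rightarrow> com \<Rightarrow> com" where
  "for_people i c = Seq (NWrite i (Num 0) (Num 0))
     (While (NLess (cell i) (cell ''n1'')) (Seq c (NWrite i (Num 0) (NAdd (cell i) (Num 1)))))"

lemma nmem_nwrite [simp]: "nmem (nwrite x i v s) = (nmem s)(x := (nmem s x)(i := v))"
  and rmem_nwrite [simp]: "rmem (nwrite x i v s) = rmem s"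
  and nmem_rwrite [simp]: "nmem (rwrite x i r s) = nmem s"
  and rmem_rwrite [simp]: "rmem (rwrite x i r s) = (rmem s)(x := (rmem s x)(i := r))"
  by (simp_all add: nwrite_def rwrite_def)

text \<open>The constants count machine steps: 3 to reset the counter and 6 for the last, failing
  test; each iteration adds 6 for the test and 6 for the increment. The invariant is required of the
  state after the increment, so it may speak of the counter's array as well.\<close>

lemma halts_for_people:
  assumes n: "nmem s ''n1'' 0 = n" and i: "i \<noteq> ''n1''"
    and init: "I 0 (nwrite i 0 0 s)"
    and step: "\<And>j s. j < n \<Longrightarrow> I j s \<Longrightarrow> nmem s i 0 = j \<Longrightarrow> nmem s ''n1'' 0 = n \<Longrightarrow>
      halts c s t (\<lambda>s'. nmem s' i 0 = j \<and> nmem s' ''n1'' 0 = n \<and> I (Suc j) (nwrite i 0 (Suc j) s'))"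
  shows "halts (for_people i c) s (9 + n * (t + 12)) (I n)"
proof -
  let ?g = "NLess (cell i) (cell ''n1'')"
  let ?b = "Seq c (NWrite i (Num 0) (NAdd (cell i) (Num 1)))"
  have loop: "halts (While ?g ?b) s (6 + (n - j) * (t + 12)) (I n)"
    if "j \<le> n" "I j s" "nmem s i 0 = j" "nmem s ''n1'' 0 = n" for j s
    using that
  proof (induction "n - j" arbitrary: j s)
    case 0
    then have "\<not> bval ?g s" "j = n" by auto
    then have "exec (While ?g ?b) s (1 + btime ?g) s" by (intro exec.WhileFalse)
    moreover have "1 + btime ?g \<le> 6 + (n - j) * (t + 12)" by simp
    ultimately show ?case using 0 \<open>j = n\<close> unfolding halts_def by blast
  next
    case (Suc m)
    then have g: "bval ?g s" and j: "j < n" by auto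
    from step[OF j Suc.prems(2-4)] obtain u s' where u: "exec c s u s'" "u \<le> t"
        "nmem s' i 0 = j" "nmem s' ''n1'' 0 = n" "I (Suc j) (nwrite i 0 (Suc j) s')"
      by (auto simp: halts_def)
    let ?s = "nwrite i 0 (Suc j) s'"
    have "exec (NWrite i (Num 0) (NAdd (cell i) (Num 1))) s' 6 ?s"
      using exec.NWrite[of i "Num 0" "NAdd (cell i) (Num 1)" s'] u(3) by (simp add: eval_nat_numeral)
    with u(1) have "exec ?b s (u + 6) ?s" by (rule exec.Seq)
    moreover have "halts (While ?g ?b) ?s (6 + (n - Suc j) * (t + 12)) (I n)"
      using Suc.hyps(2) j u i by (intro Suc.hyps(1)) auto
    then obtain v s'' where v: "exec (While ?g ?b) ?s v s''" "v \<le> 6 + (n - Suc j) * (t + 12)" "I n s''"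
      by (auto simp: halts_def)
    ultimately have "exec (While ?g ?b) s (1 + btime ?g + (u + 6) + v) s''"
      using g by (intro exec.WhileTrue)
    moreover have "1 + btime ?g + (u + 6) + v \<le> 6 + (n - j) * (t + 12)"
    proof -
      have "n - j = Suc (n - Suc j)" using j by simp
      then have "(n - j) * (t + 12) = (t + 12) + (n - Suc j) * (t + 12)" by simp
      then show ?thesis using u(2) v(2) by simp
    qed
    ultimately show ?case using v(3) unfolding halts_def by blast
  qed
  have "halts (NWrite i (Num 0) (Num 0)) s 3 (\<lambda>s'. s' = nwrite i 0 0 s)"
    using halts_loop_free[of "NWrite i (Num 0) (Num 0)" s] by (simp add: numeral_3_eq_3)
  moreover have "halts (While ?g ?b) s' (6 + n * (t + 12)) (I n)" if "s' = nwrite i 0 0 s" for s'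
    using loop[of 0 s'] that init n i by simp
  ultimately have "halts (for_people i c) s (3 + (6 + n * (t + 12))) (I n)"
    unfolding for_people_def by (rule halts_Seq)
  then show ?thesis by simp
qed

definition mark_body :: com where
  "mark_body =
     Seq (Cond (NLess (Num 0) (entry ''len'' ''i'')) (NWrite ''isfirst'' (entry ''first'' ''i'') (Num 1)) Skip)
    (Seq (NWrite ''lab'' (entry ''first'' ''i'') (entry ''first'' ''i''))
         (NWrite ''lab'' (entry ''second'' ''i'') (entry ''second'' ''i'')))"

definition same_except :: "string set \<Rightarrow> state \<Rightarrow> state \<Rightarrow> bool" where
  "same_except X s s' \<longleftrightarrow> (\<forall>x. x \<notin> X \<longrightarrow> nmem s' x = nmem s x)"

lemma same_exceptD: "same_except X s s' \<Longrightarrow> x \<notin> X \<Longrightarrow> nmem s' x = nmem s x"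
  by (simp add: same_except_def)

text \<open>Only cells named by a list entry are initialised, which keeps the time independent of
  the number of items. The guard on \<open>len\<close> prevents the default entry 0 from passing as
  a first choice; for labels the default is harmless, as cell 0 receives label 0.\<close>

lemma mark_correct:
  assumes n: "nmem s ''n1'' 0 = n"
  shows "halts (for_people ''i'' mark_body) s (9 + n * (ctime mark_body + 12))
    (\<lambda>s'. same_except {''i'', ''isfirst'', ''lab''} s s' \<and> rmem s' = rmem s \<and>
      (\<forall>b. 0 < nmem s' ''isfirst'' b \<longleftrightarrow>
         0 < nmem s ''isfirst'' b \<or> b \<in> nmem s ''first'' ` {a. a < n \<and> 0 < nmem s ''len'' a}) \<and>
      (\<forall>b \<in> nmem s ''first'' ` {..<n} \<union> nmem s ''second'' ` {..<n}. nmem s' ''lab'' b = b))"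
proof (rule halts_for_people[where I = "\<lambda>j s'. same_except {''i'', ''isfirst'', ''lab''} s s' \<and> rmem s' = rmem s \<and>
      (\<forall>b. 0 < nmem s' ''isfirst'' b \<longleftrightarrow>
         0 < nmem s ''isfirst'' b \<or> b \<in> nmem s ''first'' ` {a. a < j \<and> 0 < nmem s ''len'' a}) \<and>
      (\<forall>b \<in> nmem s ''first'' ` {..<j} \<union> nmem s ''second'' ` {..<j}. nmem s' ''lab'' b = b)", OF n], goal_cases)
  case 1
  show ?case by simp
next
  case 2
  show ?case by (simp add: same_except_def)
next
  case (3 j s')
  have eq: "nmem s' ''first'' = nmem s ''first''" "nmem s' ''second'' = nmem s ''second''"
    "nmem s' ''len'' = nmem s ''len''" using 3 by (simp_all add: same_except_def)
  have set: "{a. a < Suc j \<and> 0 < nmem s ''len'' a} =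
      (if 0 < nmem s ''len'' j then insert j else id) {a. a < j \<and> 0 < nmem s ''len'' a}"
    by (auto simp: less_Suc_eq)
  show ?case
  proof (rule halts_run)
    show "loop_free mark_body" by (simp add: mark_body_def)
    show "nmem (run mark_body s') ''i'' 0 = j \<and> nmem (run mark_body s') ''n1'' 0 = n \<and>
      same_except {''i'', ''isfirst'', ''lab''} s (nwrite ''i'' 0 (Suc j) (run mark_body s')) \<and>
      rmem (nwrite ''i'' 0 (Suc j) (run mark_body s')) = rmem s \<and>
      (\<forall>b. 0 < nmem (nwrite ''i'' 0 (Suc j) (run mark_body s')) ''isfirst'' b \<longleftrightarrow>
         0 < nmem s ''isfirst'' b \<or> b \<in> nmem s ''first'' ` {a. a < Suc j \<and> 0 < nmem s ''len'' a}) \<and>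
      (\<forall>b \<in> nmem s ''first'' ` {..<Suc j} \<union> nmem s ''second'' ` {..<Suc j}.
         nmem (nwrite ''i'' 0 (Suc j) (run mark_body s')) ''lab'' b = b)"
      using 3 unfolding set by (auto simp: mark_body_def eq same_except_def lessThan_Suc)
  qed
qed

definition prep_body :: com where
  "prep_body =
     Seq (Cond (Conj (NLess (Num 1) (entry ''len'' ''i''))
                     (NLess (NCell ''isfirst'' (entry ''second'' ''i'')) (Num 1)))
           (NWrite ''todo'' (cell ''i'') (Num 1)) Skip)
    (Cond (RLess (RCell ''cost'' (entry ''first'' ''i'')) (RCell ''cost'' (entry ''second'' ''i'')))
       (Seq (RWrite ''weight'' (cell ''i'') (RCell ''cost'' (entry ''first'' ''i'')))
            (NWrite ''cheaper'' (cell ''i'') (entry ''first'' ''i'')))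
       (Seq (RWrite ''weight'' (cell ''i'') (RCell ''cost'' (entry ''second'' ''i'')))
            (NWrite ''cheaper'' (cell ''i'') (entry ''second'' ''i''))))"

lemma prep_correct:
  assumes n: "nmem s ''n1'' 0 = n"
  defines "ch \<equiv> \<lambda>a. if rmem s ''cost'' (nmem s ''first'' a) < rmem s ''cost'' (nmem s ''second'' a)
    then nmem s ''first'' a else nmem s ''second'' a"
  defines "I \<equiv> \<lambda>j s'. same_except {''i'', ''todo'', ''cheaper''} s s' \<and> rmem s' ''cost'' = rmem s ''cost'' \<and>
      (\<forall>a. 0 < nmem s' ''todo'' a \<longleftrightarrow> 0 < nmem s ''todo'' a \<or>
         a < j \<and> 1 < nmem s ''len'' a \<and> nmem s ''isfirst'' (nmem s ''second'' a) = 0) \<and>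
      (\<forall>a<j. nmem s' ''cheaper'' a = ch a \<and> rmem s' ''weight'' a = rmem s ''cost'' (ch a))"
  shows "halts (for_people ''i'' prep_body) s (9 + n * (ctime prep_body + 12)) (I n)"
proof (rule halts_for_people[OF n], goal_cases)
  case 1
  show ?case by simp
next
  case 2
  show ?case by (simp add: same_except_def I_def)
next
  case (3 j s')
  have se: "same_except {''i'', ''todo'', ''cheaper''} s s'" and re: "rmem s' ''cost'' = rmem s ''cost''"
    and todo: "\<And>a. 0 < nmem s' ''todo'' a \<longleftrightarrow> 0 < nmem s ''todo'' a \<or>
         a < j \<and> 1 < nmem s ''len'' a \<and> nmem s ''isfirst'' (nmem s ''second'' a) = 0"
    and ch: "\<And>a. a < j \<Longrightarrow> nmem s' ''cheaper'' a = ch a"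
    and wt: "\<And>a. a < j \<Longrightarrow> rmem s' ''weight'' a = rmem s ''cost'' (ch a)"
    using 3(2) unfolding I_def by blast+
  have eq: "nmem s' ''first'' = nmem s ''first''" "nmem s' ''second'' = nmem s ''second''"
    "nmem s' ''len'' = nmem s ''len''" "nmem s' ''isfirst'' = nmem s ''isfirst''"
    by (simp_all add: same_exceptD[OF se])
  let ?s = "run prep_body s'"
  have s: "nmem ?s x = nmem s x" if "x \<notin> {''i'', ''todo'', ''cheaper''}" for x
    using that same_exceptD[OF se that] by (simp add: prep_body_def)
  have i: "nmem ?s ''i'' 0 = j" using 3(3) by (simp add: prep_body_def)
  have c: "rmem ?s ''cost'' = rmem s ''cost''" using re by (simp add: prep_body_def)
  have t: "nmem ?s ''todo'' = (if 1 < nmem s ''len'' j \<and> nmem s ''isfirst'' (nmem s ''second'' j) = 0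
      then (nmem s' ''todo'')(j := 1) else nmem s' ''todo'')"
    using 3(3) by (auto simp: prep_body_def eq)
  have h: "nmem ?s ''cheaper'' = (nmem s' ''cheaper'')(j := ch j)"
    "rmem ?s ''weight'' = (rmem s' ''weight'')(j := rmem s ''cost'' (ch j))"
    using 3(3) re by (simp_all add: prep_body_def eq ch_def)
  show ?case
  proof (rule halts_run)
    show "loop_free prep_body" by (simp add: prep_body_def)
    show "nmem ?s ''i'' 0 = j \<and> nmem ?s ''n1'' 0 = n \<and> I (Suc j) (nwrite ''i'' 0 (Suc j) ?s)"
      unfolding I_def
    proof (intro conjI allI impI)
      show "nmem ?s ''n1'' 0 = n" using s n by simp
      show "same_except {''i'', ''todo'', ''cheaper''} s (nwrite ''i'' 0 (Suc j) ?s)"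
        using s by (simp add: same_except_def)
    qed (use i c t h todo ch wt in \<open>auto simp: less_Suc_eq\<close>)
  qed
qed

text \<open>The negated conjunction is a disjunction: there is no candidate yet, or the candidate is
  lighter. Without a candidate the truncated subtraction reads the weight of person 0, but the test
  of \<open>best\<close> masks that value.\<close>

definition select_body :: com where
  "select_body =
     Cond (Conj (NLess (Num 0) (entry ''todo'' ''j''))
                (Neg (Conj (NLess (Num 0) (cell ''best''))
                           (Neg (RLess (RCell ''weight'' (NSub (cell ''best'') (Num 1)))
                                       (RCell ''weight'' (cell ''j'')))))))
       (NWrite ''best'' (Num 0) (NAdd (cell ''j'') (Num 1))) Skip"

definition select :: com where
  "select = Seq (NWrite ''best'' (Num 0) (Num 0)) (for_people ''j'' select_body)"

text \<open>Cell 0 of \<open>best\<close> holds the successor of the selected person, and 0 if there is none.\<close>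

definition selected :: "state \<Rightarrow> nat \<Rightarrow> state \<Rightarrow> bool" where
  "selected s j s' \<longleftrightarrow> same_except {''j'', ''best''} s s' \<and> rmem s' = rmem s \<and>
     (case nmem s' ''best'' 0 of
        0 \<Rightarrow> \<forall>a<j. nmem s ''todo'' a = 0
      | Suc x \<Rightarrow> x < j \<and> 0 < nmem s ''todo'' x \<and>
          (\<forall>a<j. 0 < nmem s ''todo'' a \<longrightarrow> rmem s ''weight'' a \<le> rmem s ''weight'' x))"

lemma select_correct:
  assumes n: "nmem s ''n1'' 0 = n"
  shows "halts select s (12 + n * (ctime select_body + 12)) (selected s n)"
proof -
  have "halts (NWrite ''best'' (Num 0) (Num 0)) s 3 (\<lambda>s'. s' = nwrite ''best'' 0 0 s)"
    using halts_loop_free[of "NWrite ''best'' (Num 0) (Num 0)" s] by (simp add: numeral_3_eq_3)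
  moreover have "halts (for_people ''j'' select_body) s0 (9 + n * (ctime select_body + 12)) (selected s n)"
    if s0: "s0 = nwrite ''best'' 0 0 s" for s0
  proof (rule halts_for_people, goal_cases)
    case 1
    show ?case using n s0 by simp
  next
    case 2
    show ?case by simp
  next
    case 3
    show ?case by (simp add: s0 selected_def same_except_def)
  next
    case (4 j s')
    have se: "same_except {''j'', ''best''} s s'" and re: "rmem s' = rmem s"
      and best: "case nmem s' ''best'' 0 of
        0 \<Rightarrow> \<forall>a<j. nmem s ''todo'' a = 0
      | Suc x \<Rightarrow> x < j \<and> 0 < nmem s ''todo'' x \<and>
          (\<forall>a<j. 0 < nmem s ''todo'' a \<longrightarrow> rmem s ''weight'' a \<le> rmem s ''weight'' x)"
      using 4(2) unfolding selected_def by blast+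
    let ?s = "run select_body s'"
    have todo: "nmem s' ''todo'' = nmem s ''todo''" by (simp add: same_exceptD[OF se])
    have s: "nmem ?s x = nmem s x" if "x \<notin> {''j'', ''best''}" for x
      using that same_exceptD[OF se that] by (simp add: select_body_def)
    have j: "nmem ?s ''j'' 0 = j" using 4(3) by (simp add: select_body_def)
    have r: "rmem ?s = rmem s" using re by (simp add: select_body_def)
    have b: "nmem ?s ''best'' 0 = (if 0 < nmem s ''todo'' j \<and> (0 < nmem s' ''best'' 0 \<longrightarrow>
        rmem s ''weight'' (nmem s' ''best'' 0 - 1) < rmem s ''weight'' j) then Suc j else nmem s' ''best'' 0)"
      using 4(3) by (auto simp: select_body_def todo re)
    have "case nmem ?s ''best'' 0 of
        0 \<Rightarrow> \<forall>a<Suc j. nmem s ''todo'' a = 0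
      | Suc x \<Rightarrow> x < Suc j \<and> 0 < nmem s ''todo'' x \<and>
          (\<forall>a<Suc j. 0 < nmem s ''todo'' a \<longrightarrow> rmem s ''weight'' a \<le> rmem s ''weight'' x)"
    proof (cases "nmem s' ''best'' 0")
      case 0
      with best b show ?thesis by (auto simp: less_Suc_eq)
    next
      case (Suc x)
      with best have x: "x < j" "0 < nmem s ''todo'' x"
        "\<And>a. a < j \<Longrightarrow> 0 < nmem s ''todo'' a \<Longrightarrow> rmem s ''weight'' a \<le> rmem s ''weight'' x" by auto
      show ?thesis
      proof (cases "0 < nmem s ''todo'' j \<and> rmem s ''weight'' x < rmem s ''weight'' j")
        case True
        have "rmem s ''weight'' a \<le> rmem s ''weight'' j" if "a < j" "0 < nmem s ''todo'' a" for a
          using x(3)[OF that] True by linarith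
        with True b Suc show ?thesis by (simp add: less_Suc_eq all_conj_distrib)
      next
        case False
        then have "rmem s ''weight'' j \<le> rmem s ''weight'' x" if "0 < nmem s ''todo'' j" using that by linarith
        with False b Suc x show ?thesis by (auto simp: less_Suc_eq)
      qed
    qed
    then have "selected s (Suc j) (nwrite ''j'' 0 (Suc j) ?s)"
      using s r by (simp add: selected_def same_except_def)
    moreover have "nmem ?s ''n1'' 0 = n" using s n by simp
    ultimately show ?case using j by (intro halts_run) (simp_all add: select_body_def)
  qed
  ultimately have "halts select s (3 + (9 + n * (ctime select_body + 12))) (selected s n)"
    unfolding select_def by (rule halts_Seq)
  then show ?thesis by simp
qed

definition nat_eq :: "nexp \<Rightarrow> nexp \<Rightarrow> bexp" where
  "nat_eq d e = Conj (Neg (NLess d e)) (Neg (NLess e d))"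

lemma bval_nat_eq [simp]: "bval (nat_eq d e) s \<longleftrightarrow> nval d s = nval e s"
  by (auto simp: nat_eq_def)

text \<open>Running over people instead of items makes a merge linear in \<open>n1\<close> and still
  reaches every list entry. An item may be visited many times; replacing \<open>p\<close> by
  \<open>q\<close> again changes nothing.\<close>

definition relabel_body :: com where
  "relabel_body =
     Seq (Cond (nat_eq (NCell ''lab'' (entry ''first'' ''k'')) (cell ''p''))
            (NWrite ''lab'' (entry ''first'' ''k'') (cell ''q'')) Skip)
         (Cond (nat_eq (NCell ''lab'' (entry ''second'' ''k'')) (cell ''p''))
            (NWrite ''lab'' (entry ''second'' ''k'') (cell ''q'')) Skip)"

definition relabelled :: "state \<Rightarrow> nat \<Rightarrow> state \<Rightarrow> bool" where
  "relabelled s j s' \<longleftrightarrow> same_except {''k'', ''lab''} s s' \<and> rmem s' = rmem s \<and>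
     (\<forall>b. nmem s' ''lab'' b =
        (if b \<in> nmem s ''first'' ` {..<j} \<union> nmem s ''second'' ` {..<j} \<and> nmem s ''lab'' b = nmem s ''p'' 0
         then nmem s ''q'' 0 else nmem s ''lab'' b))"

lemma relabel_correct:
  assumes n: "nmem s ''n1'' 0 = n"
  shows "halts (for_people ''k'' relabel_body) s (9 + n * (ctime relabel_body + 12)) (relabelled s n)"
proof (rule halts_for_people[OF n], goal_cases)
  case 1
  show ?case by simp
next
  case 2
  show ?case by (simp add: same_except_def relabelled_def)
next
  case (3 j s')
  have se: "same_except {''k'', ''lab''} s s'" and re: "rmem s' = rmem s"
    and lab: "\<And>b. nmem s' ''lab'' b =
        (if b \<in> nmem s ''first'' ` {..<j} \<union> nmem s ''second'' ` {..<j} \<and> nmem s ''lab'' b = nmem s ''p'' 0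
         then nmem s ''q'' 0 else nmem s ''lab'' b)"
    using 3(2) unfolding relabelled_def by blast+
  let ?s = "run relabel_body s'"
  have eq: "nmem s' ''first'' = nmem s ''first''" "nmem s' ''second'' = nmem s ''second''"
    "nmem s' ''p'' = nmem s ''p''" "nmem s' ''q'' = nmem s ''q''"
    by (simp_all add: same_exceptD[OF se])
  have s: "nmem ?s x = nmem s x" if "x \<notin> {''k'', ''lab''}" for x
    using that same_exceptD[OF se that] by (simp add: relabel_body_def)
  have k: "nmem ?s ''k'' 0 = j" using 3(3) by (simp add: relabel_body_def)
  have r: "rmem ?s = rmem s" using re by (simp add: relabel_body_def)
  have l: "nmem ?s ''lab'' b = (if (b = nmem s ''first'' j \<or> b = nmem s ''second'' j) \<and>
      nmem s' ''lab'' b = nmem s ''p'' 0 then nmem s ''q'' 0 else nmem s' ''lab'' b)" for b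
    using 3(3) by (simp add: relabel_body_def eq)
  have "nmem ?s ''lab'' b =
      (if b \<in> nmem s ''first'' ` {..<Suc j} \<union> nmem s ''second'' ` {..<Suc j} \<and> nmem s ''lab'' b = nmem s ''p'' 0
       then nmem s ''q'' 0 else nmem s ''lab'' b)" for b
    unfolding l lab by (auto simp: lessThan_Suc)
  then have "relabelled s (Suc j) (nwrite ''k'' 0 (Suc j) ?s)"
    using s r by (simp add: relabelled_def same_except_def)
  moreover have "nmem ?s ''n1'' 0 = n" using s n by simp
  ultimately show ?case using k by (intro halts_run) (simp_all add: relabel_body_def)
qed

section \<open>The greedy algorithm as a program\<close>

definition fetch :: com where
  "fetch =
     Seq (NWrite ''x'' (Num 0) (NSub (cell ''best'') (Num 1)))
    (Seq (NWrite ''todo'' (cell ''x'') (Num 0))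
    (Seq (NWrite ''p'' (Num 0) (NCell ''lab'' (entry ''first'' ''x'')))
         (NWrite ''q'' (Num 0) (NCell ''lab'' (entry ''second'' ''x'')))))"

definition both_cyclic :: bexp where
  "both_cyclic = Conj (NLess (Num 0) (entry ''cyclic'' ''p'')) (NLess (Num 0) (entry ''cyclic'' ''q''))"

definition reject :: com where
  "reject = NWrite ''extra'' (entry ''cheaper'' ''x'') (NAdd (NCell ''extra'' (entry ''cheaper'' ''x'')) (Num 1))"

text \<open>The condition is the disjunction of \<open>p = q\<close> and \<open>p\<close> being
  cyclic. The mark is put at \<open>q\<close> because that label survives the merge.\<close>

definition close_cycle :: com where
  "close_cycle =
     Cond (Neg (Conj (Neg (nat_eq (cell ''p'') (cell ''q''))) (Neg (NLess (Num 0) (entry ''cyclic'' ''p'')))))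
       (NWrite ''cyclic'' (cell ''q'') (Num 1)) Skip"

definition insert_edge :: com where
  "insert_edge = Seq fetch (Cond both_cyclic reject (Seq close_cycle (for_people ''k'' relabel_body)))"

text \<open>The times of the two branches are added, which bounds either one.\<close>

definition insert_time :: "nat \<Rightarrow> nat" where
  "insert_time n = ctime fetch + (1 + btime both_cyclic +
     (ctime reject + (ctime close_cycle + (9 + n * (ctime relabel_body + 12)))))"

definition round_body :: com where
  "round_body = Seq select (Cond (NLess (Num 0) (cell ''best'')) insert_edge Skip)"

definition round_time :: "nat \<Rightarrow> nat" where
  "round_time n = (12 + n * (ctime select_body + 12)) + (1 + btime (NLess (Num 0) (cell ''best'')) + insert_time n)"

definition augmentation_prog :: com where
  "augmentation_prog = Seq (for_people ''i'' mark_body)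
     (Seq (for_people ''i'' prep_body) (for_people ''i'' round_body))"

definition augmentation_time :: "nat \<Rightarrow> nat" where
  "augmentation_time n = (9 + n * (ctime mark_body + 12)) +
     ((9 + n * (ctime prep_body + 12)) + (9 + n * (round_time n + 12)))"

lemma augmentation_time_bigo: "(\<lambda>n. real (augmentation_time n)) \<in> O(\<lambda>n. real n ^ 2)"
proof -
  obtain a b c :: nat where abc: "\<And>n. augmentation_time n = a + n * (b + n * c)"
  proof
    fix n
    \<comment> \<open>27 is the fixed cost 9 of each of the three outer loops. Only the loops inside
      a round, for selection and relabelling, contribute to the quadratic coefficient.\<close>
    show "augmentation_time n = 27 +
      n * ((ctime mark_body + ctime prep_body + 36 + 12 + 1 + btime (NLess (Num 0) (cell ''best'')) +
         ctime fetch + 1 + btime both_cyclic + ctime reject + ctime close_cycle + 9) +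
         n * (ctime select_body + 12 + ctime relabel_body + 12))"
      by (simp add: augmentation_time_def round_time_def insert_time_def algebra_simps)
  qed
  have "\<bar>real (augmentation_time n)\<bar> \<le> real (a + b + c) * \<bar>real n ^ 2\<bar>" if n: "1 \<le> n" for n
  proof -
    have "augmentation_time n = a * 1 + b * n + c * n\<^sup>2"
      by (simp add: abc algebra_simps power2_eq_square)
    also have "\<dots> \<le> a * n\<^sup>2 + b * n\<^sup>2 + c * n\<^sup>2"
      using n by (intro add_mono mult_left_mono) (simp_all add: power2_eq_square)
    also have "\<dots> = (a + b + c) * n\<^sup>2" by (simp add: algebra_simps)
    finally have "real (augmentation_time n) \<le> real ((a + b + c) * n\<^sup>2)" by (simp only: of_nat_le_iff)
    then show ?thesis by simp
  qed
  then show ?thesis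
    by (intro bigoI[where c = "real (a + b + c)"] eventually_sequentiallyI[of 1]) simp
qed

section \<open>Simulation of the greedy algorithm by the machine\<close>

context edge_greedy
begin

definition ready :: "nat \<Rightarrow> state \<Rightarrow> nat set \<Rightarrow> nat set \<Rightarrow> bool" where
  "ready n s A R \<longleftrightarrow> nmem s ''first'' = f \<and> nmem s ''second'' = g \<and> nmem s ''n1'' 0 = n \<and>
     (\<forall>a\<in>E. rmem s ''weight'' a = weight a \<and> nmem s ''cheaper'' a = cheaper a) \<and>
     (\<forall>a. 0 < nmem s ''todo'' a \<longleftrightarrow> a \<in> E - (A \<union> R)) \<and>
     greedy_inv (nmem s ''lab'') (\<lambda>c. 0 < nmem s ''cyclic'' c) (nmem s ''extra'') A R"

lemma ready_same_except:
  assumes "ready n s A R" "same_except X s s'" "rmem s' = rmem s"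
    and "{''first'', ''second'', ''n1'', ''cheaper'', ''todo'', ''lab'', ''cyclic'', ''extra''} \<inter> X = {}"
  shows "ready n s' A R"
proof -
  have "nmem s' x = nmem s x"
    if "x \<in> {''first'', ''second'', ''n1'', ''cheaper'', ''todo'', ''lab'', ''cyclic'', ''extra''}" for x
    using that assms(2,4) by (intro same_exceptD[where X = X]) auto
  then show ?thesis using assms(1,3) by (simp add: ready_def)
qed

lemma insert_edge_correct:
  assumes ready: "ready n s A R" and x: "nmem s ''best'' 0 = Suc x" "x \<in> E - (A \<union> R)"
    and max: "\<And>d. d \<in> E - (A \<union> R) \<Longrightarrow> weight d \<le> weight x"
    and V: "V = f ` {..<n} \<union> g ` {..<n}"
  shows "halts insert_edge s (insert_time n) (\<lambda>s'. nmem s' ''i'' = nmem s ''i'' \<and>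
    (\<exists>A' R'. ready n s' A' R' \<and> A' \<union> R' = insert x (A \<union> R)))"
proof -
  note r = ready[unfolded ready_def]
  have xE: "x \<in> E" using x by simp
  have fs: "nmem s ''first'' = f" "nmem s ''second'' = g" "nmem s ''n1'' 0 = n" using r by blast+
  have wt: "rmem s ''weight'' a = weight a" "nmem s ''cheaper'' a = cheaper a" if "a \<in> E" for a
    using r that by blast+
  have todo: "0 < nmem s ''todo'' a \<longleftrightarrow> a \<in> E - (A \<union> R)" for a using r by blast
  let ?lab = "nmem s ''lab''" and ?cyc = "\<lambda>c. 0 < nmem s ''cyclic'' c"
  have inv: "greedy_inv ?lab ?cyc (nmem s ''extra'') A R" using r by blast
  define s1 where "s1 = run fetch s"
  define p where "p = ?lab (f x)"
  define q where "q = ?lab (g x)"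
  have s1: "same_except {''x'', ''todo'', ''p'', ''q''} s s1" "rmem s1 = rmem s"
    "nmem s1 ''x'' 0 = x" "nmem s1 ''todo'' = (nmem s ''todo'')(x := 0)"
    "nmem s1 ''p'' 0 = p" "nmem s1 ''q'' 0 = q"
    by (simp_all add: s1_def fetch_def same_except_def x fs p_def q_def)
  have todo1: "0 < nmem s1 ''todo'' a \<longleftrightarrow> a \<in> E - insert x (A \<union> R)" for a
    using todo[of a] by (auto simp: s1(4))
  have s1_eq: "nmem s1 ''first'' = f" "nmem s1 ''second'' = g" "nmem s1 ''n1'' 0 = n"
    "nmem s1 ''cheaper'' = nmem s ''cheaper''" "nmem s1 ''lab'' = ?lab"
    "nmem s1 ''cyclic'' = nmem s ''cyclic''" "nmem s1 ''extra'' = nmem s ''extra''"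
    "nmem s1 ''i'' = nmem s ''i''"
    using same_exceptD[OF s1(1)] fs by simp_all
  have "halts fetch s (ctime fetch) (\<lambda>s'. s' = s1)"
    unfolding s1_def by (rule halts_loop_free) (simp add: fetch_def)
  moreover have "halts (Cond both_cyclic reject (Seq close_cycle (for_people ''k'' relabel_body))) s'
      (1 + btime both_cyclic + (ctime reject + (ctime close_cycle + (9 + n * (ctime relabel_body + 12)))))
      (\<lambda>s'. nmem s' ''i'' = nmem s ''i'' \<and>
        (\<exists>A' R'. ready n s' A' R' \<and> A' \<union> R' = insert x (A \<union> R)))"
    if "s' = s1" for s'
    unfolding that
  proof (rule halts_Cond)
    assume "bval both_cyclic s1"
    then have cyc: "?cyc p" "?cyc q" by (simp_all add: both_cyclic_def s1 s1_eq)
    have inv': "greedy_inv ?lab ?cyc ((nmem s ''extra'')(cheaper x := Suc (nmem s ''extra'' (cheaper x)))) A (insert x R)"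
      using greedy_inv_reject[OF inv x(2) max] cyc by (simp add: p_def q_def)
    have "ready n (run reject s1) A (insert x R)"
      unfolding ready_def using inv' todo1 wt
      by (simp add: reject_def s1 s1_eq xE)
    moreover have "nmem (run reject s1) ''i'' = nmem s ''i''"
      by (simp add: reject_def s1_eq)
    ultimately have "halts reject s1 (ctime reject) (\<lambda>s'. nmem s' ''i'' = nmem s ''i'' \<and>
        (\<exists>A' R'. ready n s' A' R' \<and> A' \<union> R' = insert x (A \<union> R)))"
      by (intro halts_run conjI exI[of _ A] exI[of _ "insert x R"]) (auto simp: reject_def)
    then show "halts reject s1 (ctime reject + (ctime close_cycle + (9 + n * (ctime relabel_body + 12))))
      (\<lambda>s'. nmem s' ''i'' = nmem s ''i'' \<and>
        (\<exists>A' R'. ready n s' A' R' \<and> A' \<union> R' = insert x (A \<union> R)))"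
      by (rule halts_mono) auto
  next
    assume "\<not> bval both_cyclic s1"
    then have ncyc: "\<not> (?cyc p \<and> ?cyc q)" by (simp add: both_cyclic_def s1 s1_eq)
    define lab' where "lab' = (\<lambda>b. if ?lab b = p then q else ?lab b)"
    define cyc' where "cyc' = (\<lambda>c. ?cyc c \<or> c = q \<and> (p = q \<or> ?cyc p))"
    have inv': "greedy_inv lab' cyc' (nmem s ''extra'') (insert x A) R"
      using greedy_inv_accept[OF inv x(2) max _ p_def q_def lab'_def cyc'_def] ncyc
      by (simp add: p_def q_def)
    define s2 where "s2 = run close_cycle s1"
    have s2: "same_except {''cyclic''} s1 s2" "rmem s2 = rmem s1" "(\<lambda>c. 0 < nmem s2 ''cyclic'' c) = cyc'"
      by (auto simp: s2_def close_cycle_def same_except_def s1 s1_eq cyc'_def)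
    have s2_eq: "nmem s2 y = nmem s1 y" if "y \<noteq> ''cyclic''" for y
      using that by (intro same_exceptD[OF s2(1)]) simp
    have "halts close_cycle s1 (ctime close_cycle) (\<lambda>s'. s' = s2)"
      unfolding s2_def by (rule halts_loop_free) (simp add: close_cycle_def)
    moreover have "halts (for_people ''k'' relabel_body) s' (9 + n * (ctime relabel_body + 12))
      (\<lambda>s'. nmem s' ''i'' = nmem s ''i'' \<and>
        (\<exists>A' R'. ready n s' A' R' \<and> A' \<union> R' = insert x (A \<union> R)))"
      if "s' = s2" for s'
      unfolding that
    proof (rule halts_mono[OF relabel_correct])
      show "nmem s2 ''n1'' 0 = n" by (simp add: s2_eq s1_eq)
      fix s3 assume s3: "relabelled s2 n s3"
      then have se: "same_except {''k'', ''lab''} s2 s3" and re: "rmem s3 = rmem s2"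
        unfolding relabelled_def by blast+
      have lab3: "nmem s3 ''lab'' b = lab' b" if "b \<in> V" for b
        using s3 that unfolding relabelled_def by (simp add: V s2_eq s1_eq s1 lab'_def)
      have s3_eq: "nmem s3 y = nmem s1 y" if "y \<notin> {''k'', ''lab'', ''cyclic''}" for y
        using that same_exceptD[OF se, of y] by (simp add: s2_eq)
      have cyc3: "(\<lambda>c. 0 < nmem s3 ''cyclic'' c) = cyc'" using same_exceptD[OF se] s2(3) by simp
      \<comment> \<open>\<open>lab'\<close> merges labels everywhere, whereas the loop does so only
        on \<open>V\<close>, the set of list entries it visits; agreement there suffices.\<close>
      have "greedy_inv (nmem s3 ''lab'') cyc' (nmem s ''extra'') (insert x A) R"
        by (rule greedy_inv_cong[OF inv' lab3])
      then have "ready n s3 (insert x A) R"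
        unfolding ready_def cyc3 using todo1 wt by (simp add: s3_eq s1_eq re s2(2) s1(2))
      moreover have "nmem s3 ''i'' = nmem s ''i''" by (simp add: s3_eq s1_eq)
      ultimately show "nmem s3 ''i'' = nmem s ''i'' \<and>
        (\<exists>A' R'. ready n s3 A' R' \<and> A' \<union> R' = insert x (A \<union> R))" by auto
    qed simp
    ultimately have "halts (Seq close_cycle (for_people ''k'' relabel_body)) s1
      (ctime close_cycle + (9 + n * (ctime relabel_body + 12)))
      (\<lambda>s'. nmem s' ''i'' = nmem s ''i'' \<and>
        (\<exists>A' R'. ready n s' A' R' \<and> A' \<union> R' = insert x (A \<union> R)))"
      by (rule halts_Seq)
    then show "halts (Seq close_cycle (for_people ''k'' relabel_body)) s1
      (ctime reject + (ctime close_cycle + (9 + n * (ctime relabel_body + 12))))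
      (\<lambda>s'. nmem s' ''i'' = nmem s ''i'' \<and>
        (\<exists>A' R'. ready n s' A' R' \<and> A' \<union> R' = insert x (A \<union> R)))"
      by (rule halts_mono) auto
  qed
  ultimately show ?thesis unfolding insert_edge_def insert_time_def by (rule halts_Seq)
qed

lemma round_body_correct:
  assumes ready: "ready n s A R" and V: "V = f ` {..<n} \<union> g ` {..<n}" and E: "E \<subseteq> {..<n}"
  shows "halts round_body s (round_time n) (\<lambda>s'. nmem s' ''i'' = nmem s ''i'' \<and>
    (\<exists>A' R'. ready n s' A' R' \<and> (A' \<union> R' = E \<or> card (A' \<union> R') = Suc (card (A \<union> R)))))"
proof -
  have n: "nmem s ''n1'' 0 = n" using ready by (simp add: ready_def)
  have todo: "0 < nmem s ''todo'' a \<longleftrightarrow> a \<in> E - (A \<union> R)" for a using ready by (simp add: ready_def)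
  have wt: "rmem s ''weight'' a = weight a" if "a \<in> E" for a using ready that by (simp add: ready_def)
  have sub: "A \<union> R \<subseteq> E" using ready by (simp add: ready_def greedy_inv_def)
  have fin: "finite (A \<union> R)" using sub finite_E by (rule finite_subset)
  show ?thesis unfolding round_body_def round_time_def
  proof (rule halts_Seq[OF select_correct[OF n]], rule halts_Cond)
    fix s1 assume s1: "selected s n s1"
    then have se: "same_except {''j'', ''best''} s s1" and re: "rmem s1 = rmem s" by (simp_all add: selected_def)
    have ready1: "ready n s1 A R" by (rule ready_same_except[OF ready se re]) simp
    have i: "nmem s1 ''i'' = nmem s ''i''" using same_exceptD[OF se] by simp
    {
      assume "bval (NLess (Num 0) (cell ''best'')) s1"
      then obtain x where best: "nmem s1 ''best'' 0 = Suc x" using gr0_conv_Suc by auto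
      have x: "x \<in> E - (A \<union> R)"
        using s1 todo[of x] by (simp add: selected_def best)
      have max: "weight d \<le> weight x" if "d \<in> E - (A \<union> R)" for d
        using s1 that x E todo[of d] by (auto simp: selected_def best wt[symmetric])
      have card: "card (insert x (A \<union> R)) = Suc (card (A \<union> R))" using x fin by simp
      show "halts insert_edge s1 (insert_time n) (\<lambda>s'. nmem s' ''i'' = nmem s ''i'' \<and>
        (\<exists>A' R'. ready n s' A' R' \<and> (A' \<union> R' = E \<or> card (A' \<union> R') = Suc (card (A \<union> R)))))"
      proof (rule halts_mono[OF insert_edge_correct[OF ready1 best x max V] order_refl])
        fix s2 assume "nmem s2 ''i'' = nmem s1 ''i'' \<and>
          (\<exists>A' R'. ready n s2 A' R' \<and> A' \<union> R' = insert x (A \<union> R))"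
        then obtain A' R' where s2: "nmem s2 ''i'' = nmem s ''i''" "ready n s2 A' R'"
            "A' \<union> R' = insert x (A \<union> R)"
          unfolding i by blast
        have "card (A' \<union> R') = Suc (card (A \<union> R))" unfolding s2(3) by (rule card)
        with s2 show "nmem s2 ''i'' = nmem s ''i'' \<and>
          (\<exists>A' R'. ready n s2 A' R' \<and> (A' \<union> R' = E \<or> card (A' \<union> R') = Suc (card (A \<union> R))))"
          by blast
      qed
    }
    {
      assume "\<not> bval (NLess (Num 0) (cell ''best'')) s1"
      then have best: "nmem s1 ''best'' 0 = 0" by simp
      then have none: "nmem s ''todo'' a = 0" if "a < n" for a using s1 that by (simp add: selected_def)
      have "a \<notin> E - (A \<union> R)" for a
        using todo[of a] none[of a] E by (metis DiffD1 less_irrefl lessThan_iff subsetD)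
      then have "A \<union> R = E" using sub by blast
      then have "halts Skip s1 (ctime Skip) (\<lambda>s'. nmem s' ''i'' = nmem s ''i'' \<and>
        (\<exists>A' R'. ready n s' A' R' \<and> (A' \<union> R' = E \<or> card (A' \<union> R') = Suc (card (A \<union> R)))))"
        using ready1 i by (intro halts_run) auto
      then show "halts Skip s1 (insert_time n) (\<lambda>s'. nmem s' ''i'' = nmem s ''i'' \<and>
        (\<exists>A' R'. ready n s' A' R' \<and> (A' \<union> R' = E \<or> card (A' \<union> R') = Suc (card (A \<union> R)))))"
        by (rule halts_mono) (auto simp: insert_time_def)
    }
  qed
qed

text \<open>The contested persons are never counted by the program. A round processes one edge or
  finds none left, and there are at most \<open>n\<close> edges, so \<open>n\<close> rounds suffice;
  the disjunction in the invariant absorbs idle ones.\<close>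

lemma rounds_correct:
  assumes ready: "ready n s {} {}" and V: "V = f ` {..<n} \<union> g ` {..<n}" and E: "E \<subseteq> {..<n}"
  shows "halts (for_people ''i'' round_body) s (9 + n * (round_time n + 12))
    (\<lambda>s'. \<exists>A R. ready n s' A R \<and> A \<union> R = E)"
proof (rule halts_mono[OF halts_for_people[where n = n and t = "round_time n" and
        I = "\<lambda>j s'. \<exists>A R. ready n s' A R \<and> (A \<union> R = E \<or> j \<le> card (A \<union> R))"]], goal_cases)
  case 1
  show ?case using ready by (simp add: ready_def)
next
  case 2
  show ?case by simp
next
  case 3
  have "ready n (nwrite ''i'' 0 0 s) {} {}"
    by (rule ready_same_except[OF ready, where X = "{''i''}"]) (simp_all add: same_except_def)
  then show ?case by (intro exI conjI) auto
next
  case (4 j s1)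
  then obtain A R where AR: "ready n s1 A R" "A \<union> R = E \<or> j \<le> card (A \<union> R)" by blast
  have sub: "A' \<union> R' \<subseteq> E" if "ready n s' A' R'" for s' A' R'
    using that by (simp add: ready_def greedy_inv_def)
  show ?case
  proof (rule halts_mono[OF round_body_correct[OF AR(1) V E] order_refl])
    fix s2 assume s2: "nmem s2 ''i'' = nmem s1 ''i'' \<and>
      (\<exists>A' R'. ready n s2 A' R' \<and> (A' \<union> R' = E \<or> card (A' \<union> R') = Suc (card (A \<union> R))))"
    then obtain A' R' where AR': "ready n s2 A' R'" "A' \<union> R' = E \<or> card (A' \<union> R') = Suc (card (A \<union> R))" by blast
    have "A' \<union> R' = E \<or> Suc j \<le> card (A' \<union> R')"
    \<comment> \<open>Once all of \<open>E\<close> is processed, a round cannot push the number of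
      processed edges beyond \<open>card E\<close>.\<close>
    proof (cases "A \<union> R = E \<and> A' \<union> R' \<noteq> E")
      case True
      then have "card (A' \<union> R') = Suc (card E)" using AR'(2) by simp
      moreover have "card (A' \<union> R') \<le> card E" using sub[OF AR'(1)] finite_E by (rule card_mono[rotated])
      ultimately show ?thesis by simp
    qed (use AR(2) AR'(2) in auto)
    moreover have "ready n (nwrite ''i'' 0 (Suc j) s2) A' R'"
      by (rule ready_same_except[OF AR'(1), where X = "{''i''}"]) (simp_all add: same_except_def)
    moreover have "nmem s2 ''n1'' 0 = n" using AR'(1) by (simp add: ready_def)
    ultimately show "nmem s2 ''i'' 0 = j \<and> nmem s2 ''n1'' 0 = n \<and>
        (\<exists>A R. ready n (nwrite ''i'' 0 (Suc j) s2) A R \<and> (A \<union> R = E \<or> Suc j \<le> card (A \<union> R)))"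
      using s2 4(3) by auto
  qed
next
  case 5
  show ?case by simp
next
  case (6 s')
  then obtain A R where AR: "ready n s' A R" "A \<union> R = E \<or> n \<le> card (A \<union> R)" by blast
  have sub: "A \<union> R \<subseteq> E" using AR(1) by (simp add: ready_def greedy_inv_def)
  have "card E \<le> n" using card_mono[OF _ E] by simp
  then have "A \<union> R = E" using AR(2) sub finite_E by (metis card_seteq order_trans)
  with AR(1) show ?case by blast
qed

end

theorem theorem3:
  "\<exists>(prog :: com) (T :: nat \<Rightarrow> nat).
     (\<lambda>n. real (T n)) \<in> O(\<lambda>n. real n ^ 2) \<and>
     (\<forall>(G :: (nat, nat) pref_instance) (cost :: nat \<Rightarrow> real) (n1 :: nat) (n2 :: nat).
        people G = {..<n1} \<and> items G = {..<n2} \<and>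
        augmentation_input G cost \<and> strict_prefs G \<and> lists_length_le 2 G \<longrightarrow>
        (\<exists>t s. exec prog (encode G cost) t s \<and> t \<le> T n1 \<and>
               min_cost_augmentation G cost (extra_copies s)))"
proof (intro exI[of _ augmentation_prog] exI[of _ augmentation_time] conjI allI impI)
  show "(\<lambda>n. real (augmentation_time n)) \<in> O(\<lambda>n. real n ^ 2)" by (rule augmentation_time_bigo)
next
  fix G :: "(nat, nat) pref_instance" and cost :: "nat \<Rightarrow> real" and n1 n2 :: nat
  assume asm: "people G = {..<n1} \<and> items G = {..<n2} \<and>
    augmentation_input G cost \<and> strict_prefs G \<and> lists_length_le 2 G"
  then have people: "people G = {..<n1}" and input: "augmentation_input G cost"
    and strict: "strict_prefs G" and short: "lists_length_le 2 G" by blast+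
  define s0 where "s0 = encode G cost"
  define f where "f = nmem s0 ''first''"
  define g where "g = nmem s0 ''second''"
  define len where "len = nmem s0 ''len''"
  have s0: "nmem s0 ''n1'' 0 = n1" "nmem s0 ''isfirst'' = (\<lambda>_. 0)" "nmem s0 ''todo'' = (\<lambda>_. 0)"
    "nmem s0 ''cyclic'' = (\<lambda>_. 0)" "nmem s0 ''extra'' = (\<lambda>_. 0)"
    "rmem s0 ''cost'' = (\<lambda>b. if b \<in> items G then cost b else 0)"
    by (simp_all add: s0_def encode_def people)
  have pref_inst: "preference_instance G" using input by (simp add: augmentation_input_def)
  have fin_acc: "finite (acceptable G a)" for a
    by (rule finite_subset[of _ "items G"])
      (use pref_inst in \<open>auto simp: preference_instance_def acceptable_def\<close>)
  have lists: "len a = length (pref_list G a)" "0 < len a \<Longrightarrow> f a = pref_list G a ! 0"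
    "1 < len a \<Longrightarrow> g a = pref_list G a ! 1" if "a \<in> people G" for a
    using that by (simp_all add: len_def f_def g_def s0_def encode_def)
  have short_lists: "short_lists G len f g"
  proof
    fix a assume a: "a \<in> people G"
    have inj: "inj_on (rank G a) (acceptable G a)" and card: "card (acceptable G a) \<le> 2"
      using strict short a by (simp_all add: strict_prefs_def lists_length_le_def)
    note L = pref_list_short[OF fin_acc inj card]
    show "acceptable G a = (if len a = 0 then {} else if len a = 1 then {f a} else {f a, g a})"
    proof -
      consider "len a = 0" | "len a = 1" | "1 < len a" by linarith
      then show ?thesis using L(1) lists[OF a] by cases auto
    qed
    show "rank G a (f a) < rank G a (g a)" if "1 < len a"
      using L(2) lists[OF a] that by (cases "pref_list G a = []") auto
  qed (rule pref_inst)
  interpret short_lists G len f g by (rule short_lists)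
  \<comment> \<open>The entries of all people are taken, including the default 0 of short lists,
    because these are the cells that the loops visit.\<close>
  define V where "V = f ` {..<n1} \<union> g ` {..<n1}"
  have cont: "contested \<subseteq> {..<n1}" using contested_people people by simp
  have V: "finite V" "f ` contested \<union> g ` contested \<subseteq> V" using cont by (auto simp: V_def)
  interpret edge_greedy f g contested V cost
    using V finite_subset[OF contested_people finite_people] by unfold_locales auto
  have "halts augmentation_prog s0 (augmentation_time n1) (\<lambda>s. min_cost_augmentation G cost (extra_copies s))"
    unfolding augmentation_prog_def augmentation_time_def
  proof (rule halts_Seq[OF mark_correct[OF s0(1)]], rule halts_Seq[OF prep_correct], goal_cases)
    case (1 s1)
    then have "same_except {''i'', ''isfirst'', ''lab''} s0 s1" by blast
    then show ?case using s0(1) by (simp add: same_except_def)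
  next
    case (2 s1 s2)
    have se1: "same_except {''i'', ''isfirst'', ''lab''} s0 s1" and re1: "rmem s1 = rmem s0"
      and first1: "\<And>b. 0 < nmem s1 ''isfirst'' b \<longleftrightarrow> b \<in> f ` {a. a < n1 \<and> 0 < len a}"
      and lab1: "\<And>b. b \<in> V \<Longrightarrow> nmem s1 ''lab'' b = b"
      using 2(1) by (simp_all add: s0 f_def g_def len_def V_def)
    have eq1: "nmem s1 ''first'' = f" "nmem s1 ''second'' = g" "nmem s1 ''len'' = len"
      "nmem s1 ''n1'' 0 = n1" "nmem s1 ''todo'' = (\<lambda>_. 0)" "nmem s1 ''cyclic'' = (\<lambda>_. 0)"
      "nmem s1 ''extra'' = (\<lambda>_. 0)"
      by (simp_all add: same_exceptD[OF se1] f_def g_def len_def s0)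
    have se2: "same_except {''i'', ''todo'', ''cheaper''} s1 s2"
      and todo2: "\<And>a. 0 < nmem s2 ''todo'' a \<longleftrightarrow> a < n1 \<and> 1 < len a \<and> nmem s1 ''isfirst'' (g a) = 0"
      and ch2: "\<And>a. a < n1 \<Longrightarrow> nmem s2 ''cheaper'' a =
          (if rmem s0 ''cost'' (f a) < rmem s0 ''cost'' (g a) then f a else g a) \<and>
          rmem s2 ''weight'' a = rmem s0 ''cost'' (if rmem s0 ''cost'' (f a) < rmem s0 ''cost'' (g a) then f a else g a)"
      using 2(2) by (simp_all add: eq1 re1)
    \<comment> \<open>The price array is 0 outside \<open>items G\<close>; it agrees with
      \<open>cost\<close> at the endpoints of contested persons because these are items.\<close>
    have items: "f a \<in> items G" "g a \<in> items G" if "a \<in> contested" for a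
      using acceptable_contested[OF that] acceptable_items by blast+
    have "ready n1 s2 {} {}"
      unfolding ready_def
    proof (intro conjI ballI allI)
      show "nmem s2 ''first'' = f" "nmem s2 ''second'' = g" "nmem s2 ''n1'' 0 = n1"
        by (simp_all add: same_exceptD[OF se2] eq1)
      show "rmem s2 ''weight'' a = weight a" "nmem s2 ''cheaper'' a = cheaper a" if "a \<in> contested" for a
        using ch2[of a] items[OF that] that cont by (auto simp: weight_def cheaper_def s0)
      show "0 < nmem s2 ''todo'' a \<longleftrightarrow> a \<in> contested - ({} \<union> {})" for a
        using todo2[of a] first1[of "g a"] by (auto simp: contested_def people first_choices_def)
      have "greedy_inv (nmem s2 ''lab'') (\<lambda>_. False) (\<lambda>_. 0) {} {}"
        by (rule greedy_inv_cong[OF greedy_inv_init]) (simp add: same_exceptD[OF se2] lab1)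
      then show "greedy_inv (nmem s2 ''lab'') (\<lambda>c. 0 < nmem s2 ''cyclic'' c) (nmem s2 ''extra'') {} {}"
        by (simp add: same_exceptD[OF se2] eq1)
    qed
    from rounds_correct[OF this V_def cont] show ?case
    proof (rule halts_mono)
      fix s assume "\<exists>A R. ready n1 s A R \<and> A \<union> R = contested"
      then obtain A R where "ready n1 s A R" "A \<union> R = contested" by blast
      then show "min_cost_augmentation G cost (extra_copies s)"
        unfolding extra_copies_def ready_def
        using min_cost_augmentation_greedy[OF short_lists input V] by blast
    qed simp
  qed
  then show "\<exists>t s. exec augmentation_prog (encode G cost) t s \<and> t \<le> augmentation_time n1 \<and>
      min_cost_augmentation G cost (extra_copies s)"
    by (simp add: halts_def s0_def)
qed

end
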